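(* Let $c>0$ and $l\in\mathbb{N}_0$. There is a constant $C>0$ (independent of $y$ and $j$) such that the following estimates hold for all $y>0$: (i) $\left|\partial_y^l\left(\int_0^\infty y\frac{e^{-cy^2/t}}{t^{3/2}}G(t,j)\,dt\right)\right|\le\frac{C}{y^l(1+|j|)}$, $j\in\mathbb{Z}$. (ii) $\left|\partial_y^l\left(\int_0^\infty y\frac{e^{-cy^2/t}}{t^{3/2}}G(t,j)\,dt\right)\right|\le\frac{Cy}{y^l|j|^2}$, $j\ne0$. (iii) $\left|\partial_y^l\delta_{right/left}\left(\int_0^\infty y\frac{e^{-cy^2/t}}{t^{3/2}}G(t,j)\,dt\right)\right|\le\frac{C}{y^{l+2}}$, $j\in\mathbb{Z}$. (iv) $\left|\partial_y^l\delta_{right/left}\left(\int_0^\infty y\frac{e^{-cy^2/t}}{t^{3/2}}G(t,j)\,dt\right)\right|\le\frac{C}{y^l|j|^2}$, $j\neq0$.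
   Context: $G(t,n)=e^{-2t}I_n(2t)$ for $t>0$, $n\in\mathbb{Z}$, is the discrete heat kernel, where $I_n(t)=\sum_{m=0}^\infty\frac{1}{m!\,\Gamma(m+n+1)}(t/2)^{2m+n}$ for $n\in\mathbb{N}_0$ and $I_{-n}=I_n$. $\delta_{right}f(j)=f(j)-f(j+1)$ and $\delta_{left}f(j)=f(j)-f(j-1)$ act in the integer variable $j$; a statement with $\delta_{right/left}$ is asserted for $\delta_{right}$ and for $\delta_{left}$. *)

theory Defs
  imports "HOL-Analysis.Analysis"
begin

definition bessel_I :: "int \<Rightarrow> real \<Rightarrow> real" where
  "bessel_I n t =
     (let k = nat \<bar>n\<bar> in
      \<Sum>m. 1 / (fact m * Gamma (real m + real k + 1)) * (t / 2) ^ (2 * m + k))"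

definition heat_kernel :: "real \<Rightarrow> int \<Rightarrow> real" where
  "heat_kernel t n = exp (- 2 * t) * bessel_I n (2 * t)"

definition delta_right :: "(int \<Rightarrow> real) \<Rightarrow> int \<Rightarrow> real" where
  "delta_right f j = f j - f (j + 1)"

definition delta_left :: "(int \<Rightarrow> real) \<Rightarrow> int \<Rightarrow> real" where
  "delta_left f j = f j - f (j - 1)"

definition heat_integrand :: "real \<Rightarrow> real \<Rightarrow> int \<Rightarrow> real \<Rightarrow> real" where
  "heat_integrand c y j t = y * (exp (- c * y\<^sup>2 / t) / t powr (3 / 2)) * heat_kernel t j"

definition heat_integral :: "real \<Rightarrow> real \<Rightarrow> int \<Rightarrow> real" where
  "heat_integral c y j = (LBINT t:{0<..}. heat_integrand c y j t)"

(* deriv is total, so a bound on (deriv ^^ l) f y says something about the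
   l-th derivative only together with this predicate. *)
definition times_differentiable_at :: "nat \<Rightarrow> (real \<Rightarrow> real) \<Rightarrow> real \<Rightarrow> bool" where
  "times_differentiable_at l f y \<longleftrightarrow> (\<forall>k<l. (deriv ^^ k) f differentiable (at y))"

end

theory Submission
  imports Defs
begin

text \<open>
  Everything is reduced to bounds on the heat kernel \<open>G(t,j)\<close> for fixed \<open>j\<close>. The \<open>y\<close>-dependence
  sits in the factor \<open>y exp(-c y\<^sup>2/t)\<close> alone, and \<open>y\<close> times this exponential is homogeneous: its
  \<open>l\<close>-th \<open>y\<close>-derivative is \<open>y\<^sup>1\<^sup>-\<^sup>l p(u) exp(-c u)\<close> with \<open>u = y\<^sup>2/t\<close> and a polynomial \<open>p\<close> that depends on
  \<open>c\<close> and \<open>l\<close> only. Half of the exponential absorbs \<open>p\<close>, so each derivative costs exactly a factor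
  \<open>1/y\<close> and, for \<open>H(t) = G(t,j)\<close> or \<open>H(t) = G(t,j) - G(t,j+1)\<close>, it remains to bound
  \<open>y\<^sup>1\<^sup>-\<^sup>l \<integral> exp(-a/t) t\<^sup>-\<^sup>3\<^sup>/\<^sup>2 \<bar>H(t)\<bar> dt\<close> with \<open>a = c y\<^sup>2/2\<close>. Because \<open>exp(-a/t) \<le> t/(t+a)\<close>, the
  weight is dominated by \<open>1/(sqrt t (t+a))\<close>, whose integral over the half-line is \<open>pi / sqrt a\<close>. Hence

    \<^item> \<open>\<bar>H\<bar> \<le> M\<close> gives a multiple of \<open>M y\<^sup>-\<^sup>l\<close> (\<open>weighted_integral_bounded_le\<close>);

    \<^item> \<open>\<bar>H\<bar> \<le> M/t\<close> gives a multiple of \<open>M y\<^sup>-\<^sup>l\<^sup>-\<^sup>2\<close> (\<open>weighted_integral_inverse_le\<close>);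

    \<^item> \<open>\<bar>H\<bar> \<le> M t/(t+k\<^sup>2)\<close> gives a multiple of \<open>M y\<^sup>1\<^sup>-\<^sup>l/k\<close> (\<open>weighted_integral_saturating_le\<close>).

  The four estimates then follow from \<open>\<bar>G\<bar> \<le> 1\<close>, \<open>\<bar>j\<bar> \<bar>G\<bar> \<le> 1\<close>, \<open>\<bar>j\<bar>\<^sup>3 \<bar>G\<bar> \<le> 24 t\<close>,
  \<open>t \<bar>\<delta>G\<bar> \<le> 1\<close> and \<open>j\<^sup>2 \<bar>\<delta>G\<bar> \<le> 13\<close>, where \<open>\<delta>\<close> is \<open>delta_right\<close>; the evenness of \<open>G\<close> in \<open>j\<close> reduces
  \<open>delta_left\<close> at \<open>j\<close> to \<open>delta_right\<close> at \<open>-j\<close>.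

  For the kernel bounds, \<open>G(t,j)\<close> is the \<open>j\<close>-th Fourier coefficient of \<open>exp(-2t(1 - cos \<theta>))\<close>, which is
  dominated by the Gaussian \<open>exp(-4t\<theta>\<^sup>2/pi\<^sup>2)\<close>. Differences in \<open>j\<close> put powers of \<open>\<theta>\<close> under this
  integral and therefore gain powers of \<open>1/sqrt t\<close>. The recurrence \<open>j G(t,j) = t (G(t,j-1) - G(t,j+1))\<close>
  trades a power of \<open>j\<close> for a factor \<open>t\<close> and a difference; iterating it expresses \<open>j\<^sup>3 G\<close> and
  \<open>j\<^sup>2 \<delta>G\<close> by differences of \<open>G\<close> with exactly the powers of \<open>t\<close> that those differences compensate.
\<close>

section \<open>The Bessel functions as Fourier coefficients\<close>

text \<open>
  The binomial coefficient with an integer lower index, zero outside Pascal's triangle; with it the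
  moments of the cosine need no case distinction at the boundary of the triangle.
\<close>
definition binomial_int :: "nat \<Rightarrow> int \<Rightarrow> real" where
  "binomial_int m s = (if s < 0 then 0 else real (m choose nat s))"

lemma binomial_int_Suc: "binomial_int (Suc m) s = binomial_int m s + binomial_int m (s - 1)"
proof (cases "s \<le> 0")
  case False
  then obtain k where "s = 1 + int k"
    by (metis zle_iff_zadd not_le int_one_le_iff_zero_less)
  then show ?thesis
    by (simp add: binomial_int_def nat_add_distrib)
qed (auto simp: binomial_int_def)

lemma cos_of_int_integral:
  "((\<lambda>\<theta>. cos (of_int N * \<theta>)) has_integral (if N = 0 then pi else 0)) {0..pi}"
proof (cases "N = 0")
  case True
  then show ?thesis
    using has_integral_const_real[of "1::real" 0 pi] by simp
next
  case False
  have "((\<lambda>\<theta>. cos (of_int N * \<theta>)) has_integral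
           (sin (of_int N * pi) / of_int N - sin (of_int N * 0) / of_int N)) {0..pi}"
  proof (rule fundamental_theorem_of_calculus)
    fix x
    show "((\<lambda>x. sin (of_int N * x) / of_int N) has_vector_derivative cos (of_int N * x)) (at x within {0..pi})"
      unfolding has_real_derivative_iff_has_vector_derivative[symmetric]
      using False by (auto intro!: derivative_eq_intros)
  qed simp
  moreover have "sin (of_int N * pi) = 0"
    by (simp add: sin_int_times_real mult.commute)
  ultimately show ?thesis
    using False by simp
qed

text \<open>
  Expanding \<open>cos \<theta> ^ m\<close> into exponentials leaves only frequencies \<open>m - 2 s\<close>, with binomial weights.
  In real form this is an induction on \<open>m\<close> by \<open>cos \<theta> cos N\<theta> = (cos (N+1)\<theta> + cos (N-1)\<theta>) / 2\<close>, which
  is Pascal's rule for the frequencies \<open>N\<close> of the parity of \<open>m\<close> and keeps the others at zero.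
\<close>
lemma cos_power_moment:
  "((\<lambda>\<theta>. cos \<theta> ^ m * cos (of_int (int m - 2 * s) * \<theta>)) has_integral
      pi * binomial_int m s / 2 ^ m) {0..pi} \<and>
   ((\<lambda>\<theta>. cos \<theta> ^ m * cos (of_int (int m - 2 * s + 1) * \<theta>)) has_integral 0) {0..pi}"
proof (induction m arbitrary: s)
  case 0
  have "1 - 2 * s \<noteq> 0"
    by presburger
  moreover have "binomial_int 0 s = (if s = 0 then 1 else 0)"
    by (auto simp: binomial_int_def binomial_eq_0)
  ultimately show ?case
    using cos_of_int_integral[of "- 2 * s"] cos_of_int_integral[of "1 - 2 * s"]
    by (auto simp: algebra_simps)
next
  case (Suc m)
  have product_to_sum: "cos \<theta> ^ Suc m * cos (of_int N * \<theta>) =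
      (1 / 2) * (cos \<theta> ^ m * cos (of_int (N + 1) * \<theta>) + cos \<theta> ^ m * cos (of_int (N - 1) * \<theta>))"
    for N and \<theta> :: real
    by (simp add: algebra_simps cos_add cos_diff)
  have even: "int (Suc m) - 2 * s + 1 = int m - 2 * (s - 1)" "int (Suc m) - 2 * s - 1 = int m - 2 * s"
    and odd: "int (Suc m) - 2 * s + 1 + 1 = int m - 2 * (s - 1) + 1"
      "int (Suc m) - 2 * s + 1 - 1 = int m - 2 * s + 1"
    by auto
  have "((\<lambda>\<theta>. cos \<theta> ^ Suc m * cos (of_int (int (Suc m) - 2 * s) * \<theta>)) has_integral
      (1 / 2) * (pi * binomial_int m (s - 1) / 2 ^ m + pi * binomial_int m s / 2 ^ m)) {0..pi}"
    unfolding product_to_sum even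
    by (intro has_integral_mult_right has_integral_add conjunct1[OF Suc])
  moreover have "((\<lambda>\<theta>. cos \<theta> ^ Suc m * cos (of_int (int (Suc m) - 2 * s + 1) * \<theta>)) has_integral
      (1 / 2) * (0 + 0)) {0..pi}"
    unfolding product_to_sum odd
    by (intro has_integral_mult_right has_integral_add conjunct2[OF Suc])
  ultimately show ?case
    by (simp add: binomial_int_Suc field_simps)
qed

text \<open>
  The exponential series of \<open>exp (x cos \<theta>)\<close> converges uniformly and is integrated term by term. Only
  the powers \<open>m = 2 r + k\<close> contribute, and their moments turn it into the series of \<open>bessel_I\<close>.
\<close>
lemma bessel_I_integral_nat:
  "((\<lambda>\<theta>. exp (x * cos \<theta>) * cos (real k * \<theta>)) has_integral pi * bessel_I (int k) x) {0..pi}"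
proof -
  define f where "f = (\<lambda>m \<theta>. (x * cos \<theta>) ^ m / fact m * cos (real k * \<theta>))"
  have "uniform_limit {0..pi} (\<lambda>n \<theta>. \<Sum>m<n. f m \<theta>) (\<lambda>\<theta>. suminf (\<lambda>m. f m \<theta>)) sequentially"
  proof (rule Weierstrass_m_test)
    show "norm (f m \<theta>) \<le> \<bar>x\<bar> ^ m / fact m" for m \<theta>
    proof -
      have "\<bar>cos \<theta>\<bar> ^ m * \<bar>cos (real k * \<theta>)\<bar> \<le> 1 * 1"
        by (intro mult_mono power_le_one) auto
      then have "\<bar>x\<bar> ^ m * (\<bar>cos \<theta>\<bar> ^ m * \<bar>cos (real k * \<theta>)\<bar>) \<le> \<bar>x\<bar> ^ m * 1"
        by (intro mult_left_mono) auto
      then show ?thesis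
        by (simp add: f_def abs_mult power_abs power_mult_distrib divide_right_mono mult.assoc)
    qed
    show "summable (\<lambda>m. \<bar>x\<bar> ^ m / fact m)"
      using summable_exp[of "\<bar>x\<bar>"] by (simp add: divide_inverse mult.commute)
  qed
  moreover have "suminf (\<lambda>m. f m \<theta>) = exp (x * cos \<theta>) * cos (real k * \<theta>)" for \<theta>
  proof (rule sums_unique[symmetric])
    show "(\<lambda>m. f m \<theta>) sums (exp (x * cos \<theta>) * cos (real k * \<theta>))"
      unfolding f_def
      using sums_mult2[OF exp_converges[of "x * cos \<theta>"], of "cos (real k * \<theta>)"]
      by (simp add: divide_inverse mult.commute mult.left_commute)
  qed
  ultimately have "uniform_limit {0..pi} (\<lambda>n \<theta>. \<Sum>m<n. f m \<theta>)
      (\<lambda>\<theta>. exp (x * cos \<theta>) * cos (real k * \<theta>)) sequentially"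
    by simp
  moreover have "continuous_on {0..pi} (\<lambda>\<theta>. \<Sum>m<n. f m \<theta>)" for n
    unfolding f_def by (intro continuous_intros) auto
  ultimately obtain I J where
    I: "\<And>n. ((\<lambda>\<theta>. \<Sum>m<n. f m \<theta>) has_integral I n) {0..pi}"
    and J: "((\<lambda>\<theta>. exp (x * cos \<theta>) * cos (real k * \<theta>)) has_integral J) {0..pi}"
    and lim: "I \<longlonglongrightarrow> J"
    by (rule uniform_limit_integral) auto
  \<comment> \<open>\<open>a m\<close> is the contribution of the \<open>m\<close>-th power of \<open>x\<close>.\<close>
  define a where "a = (\<lambda>m. integral {0..pi} (f m))"
  have f_eq: "f m = (\<lambda>\<theta>. x ^ m / fact m * (cos \<theta> ^ m * cos (real k * \<theta>)))" for m
    by (auto simp: f_def power_mult_distrib)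
  have f_int: "(f m has_integral a m) {0..pi}" for m
    unfolding a_def f_def
    by (intro integrable_integral integrable_continuous_real continuous_intros) auto
  have "I = (\<lambda>n. \<Sum>m<n. a m)"
  proof
    fix n
    have "((\<lambda>\<theta>. \<Sum>m<n. f m \<theta>) has_integral (\<Sum>m<n. a m)) {0..pi}"
      by (intro has_integral_sum f_int) auto
    with I[of n] show "I n = (\<Sum>m<n. a m)"
      by (rule has_integral_unique)
  qed
  with lim have a_sums: "a sums J"
    by (simp add: sums_def)
  have a_even: "a m = x ^ m / fact m * (pi * binomial_int m s / 2 ^ m)"
    if "int m = int k + 2 * s" for m s
  proof -
    have "(f m has_integral x ^ m / fact m * (pi * binomial_int m s / 2 ^ m)) {0..pi}"
      unfolding f_eq using that
      by (intro has_integral_mult_right) (use cos_power_moment[of m s] in simp)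
    with f_int[of m] show ?thesis
      by (rule has_integral_unique)
  qed
  have a_zero: "a m = 0" if "m \<notin> range (\<lambda>r. 2 * r + k)" for m
  proof (cases "even (int m - int k)")
    case True
    then obtain s where "int m - int k = 2 * s"
      by (elim evenE)
    then have s: "int m = int k + 2 * s"
      by simp
    have "s < 0"
    proof (rule ccontr)
      assume "\<not> s < 0"
      with s have "m = 2 * nat s + k"
        by linarith
      with that show False
        by (metis rangeI)
    qed
    with a_even[OF s] show ?thesis
      by (simp add: binomial_int_def)
  next
    case False
    then obtain s where s: "int m - int k = 2 * s + 1"
      by (elim oddE)
    then have "(f m has_integral x ^ m / fact m * 0) {0..pi}"
      unfolding f_eq
      by (intro has_integral_mult_right) (use cos_power_moment[of m "s + 1"] in \<open>simp add: algebra_simps\<close>)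
    with f_int[of m] have "a m = x ^ m / fact m * 0"
      by (rule has_integral_unique)
    then show ?thesis
      by simp
  qed
  have "strict_mono (\<lambda>r. 2 * r + k)"
    by (simp add: strict_mono_def)
  from sums_mono_reindex[of _ a, OF this a_zero] a_sums have sums: "(\<lambda>r. a (2 * r + k)) sums J"
    by blast
  have "a (2 * r + k) = pi * (1 / (fact r * Gamma (real r + real k + 1)) * (x / 2) ^ (2 * r + k))" for r
  proof -
    have "Gamma (real r + real k + 1) = fact (r + k)"
      using Gamma_fact[of "r + k", where ?'a = real] by (simp add: algebra_simps)
    moreover have "real ((2 * r + k) choose r) = fact (2 * r + k) / (fact r * fact (r + k))"
      using binomial_fact[of r "2 * r + k", where ?'a = real] by (simp add: mult_2)
    ultimately show ?thesis
      by (simp add: a_even[of "2 * r + k" "int r"] binomial_int_def power_divide)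
  qed
  with sums have "(\<lambda>r. pi * (1 / (fact r * Gamma (real r + real k + 1)) * (x / 2) ^ (2 * r + k))) sums J"
    by simp
  from sums_mult[OF this, of "1 / pi"] have "bessel_I (int k) x = J / pi"
    unfolding bessel_I_def Let_def by (simp add: sums_iff)
  with J show ?thesis
    by simp
qed

lemma bessel_I_minus: "bessel_I (- n) x = bessel_I n x"
  by (simp add: bessel_I_def)

lemma bessel_I_integral:
  "((\<lambda>\<theta>. exp (x * cos \<theta>) * cos (of_int n * \<theta>)) has_integral pi * bessel_I n x) {0..pi}"
proof (cases n rule: int_cases2)
  case (nonneg k)
  then show ?thesis using bessel_I_integral_nat[of x k] by simp
next
  case (nonpos k)
  then show ?thesis using bessel_I_integral_nat[of x k] by (simp add: bessel_I_minus)
qed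

section \<open>The heat kernel: Fourier representation and recurrence\<close>

lemma heat_kernel_minus: "heat_kernel t (- j) = heat_kernel t j"
  by (simp add: heat_kernel_def bessel_I_minus)

lemma heat_kernel_integral:
  "((\<lambda>\<theta>. exp (- (2 * t * (1 - cos \<theta>))) * cos (of_int j * \<theta>)) has_integral pi * heat_kernel t j) {0..pi}"
proof -
  have "((\<lambda>\<theta>. exp (- 2 * t) * (exp (2 * t * cos \<theta>) * cos (of_int j * \<theta>))) has_integral
          exp (- 2 * t) * (pi * bessel_I j (2 * t))) {0..pi}"
    by (intro has_integral_mult_right bessel_I_integral)
  moreover have "exp (- 2 * t) * (exp (2 * t * cos \<theta>) * cos (of_int j * \<theta>)) =
      exp (- (2 * t * (1 - cos \<theta>))) * cos (of_int j * \<theta>)" for \<theta>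
  proof -
    have "exp (- 2 * t) * exp (2 * t * cos \<theta>) = exp (- (2 * t * (1 - cos \<theta>)))"
      unfolding exp_add[symmetric] by (simp add: right_diff_distrib)
    then show ?thesis
      by (simp only: mult.assoc[symmetric])
  qed
  ultimately have "((\<lambda>\<theta>. exp (- (2 * t * (1 - cos \<theta>))) * cos (of_int j * \<theta>)) has_integral
      exp (- 2 * t) * (pi * bessel_I j (2 * t))) {0..pi}"
    by (simp only:)
  then show ?thesis
    by (simp add: heat_kernel_def mult.left_commute)
qed

text \<open>
  Integration by parts in the Fourier representation: this is the integral of the derivative of
  \<open>exp (- (2 t (1 - cos \<theta>))) sin (j \<theta>)\<close>, which vanishes at both ends.
\<close>
lemma heat_kernel_recurrence:
  "of_int j * heat_kernel t j = t * (heat_kernel t (j - 1) - heat_kernel t (j + 1))"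
proof -
  let ?E = "\<lambda>\<theta>::real. exp (- (2 * t * (1 - cos \<theta>)))"
  let ?c = "\<lambda>(j::int) \<theta>::real. ?E \<theta> * cos (of_int j * \<theta>)"
  have ftc: "((\<lambda>\<theta>. of_int j * ?c j \<theta> - t * (?c (j - 1) \<theta> - ?c (j + 1) \<theta>)) has_integral
      ?E pi * sin (of_int j * pi) - ?E 0 * sin (of_int j * 0)) {0..pi}"
  proof (rule fundamental_theorem_of_calculus)
    fix \<theta> :: real
    have "of_int j * ?c j \<theta> - t * (?c (j - 1) \<theta> - ?c (j + 1) \<theta>) =
        ?E \<theta> * (- (2 * t * sin \<theta>)) * sin (of_int j * \<theta>) + ?E \<theta> * (cos (of_int j * \<theta>) * of_int j)"
      by (simp add: left_diff_distrib distrib_right cos_diff cos_add algebra_simps)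
    moreover have "((\<lambda>\<theta>. ?E \<theta> * sin (of_int j * \<theta>)) has_real_derivative
        ?E \<theta> * (- (2 * t * sin \<theta>)) * sin (of_int j * \<theta>) + ?E \<theta> * (cos (of_int j * \<theta>) * of_int j))
        (at \<theta> within {0..pi})"
      by (auto intro!: derivative_eq_intros)
    ultimately show "((\<lambda>\<theta>. ?E \<theta> * sin (of_int j * \<theta>)) has_vector_derivative
        of_int j * ?c j \<theta> - t * (?c (j - 1) \<theta> - ?c (j + 1) \<theta>)) (at \<theta> within {0..pi})"
      unfolding has_real_derivative_iff_has_vector_derivative[symmetric] by (simp only:)
  qed simp
  have linear: "((\<lambda>\<theta>. of_int j * ?c j \<theta> - t * (?c (j - 1) \<theta> - ?c (j + 1) \<theta>)) has_integral
      of_int j * (pi * heat_kernel t j) - t * (pi * heat_kernel t (j - 1) - pi * heat_kernel t (j + 1))) {0..pi}"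
    by (intro has_integral_diff has_integral_mult_right heat_kernel_integral)
  have "sin (of_int j * pi) = 0"
    by (simp add: sin_int_times_real mult.commute)
  with has_integral_unique[OF linear ftc] have "of_int j * (pi * heat_kernel t j) - t * (pi * heat_kernel t (j - 1) - pi * heat_kernel t (j + 1)) = 0"
    by simp
  then have "pi * (of_int j * heat_kernel t j - t * (heat_kernel t (j - 1) - heat_kernel t (j + 1))) = 0"
    by (simp add: algebra_simps)
  then show ?thesis
    by simp
qed

section \<open>Bounds on the heat kernel and its differences\<close>

text \<open>
  Jordan's inequality \<open>sin x \<ge> 2 x / pi\<close>, from concavity, at \<open>x = \<theta> / 2\<close>.
\<close>
lemma one_minus_cos_lower_bound:
  assumes "0 \<le> \<theta>" "\<theta> \<le> pi"
  shows "2 * (\<theta> / pi)\<^sup>2 \<le> 1 - cos \<theta>"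
proof -
  have "concave_on {0..pi / 2} sin"
    by (rule f''_le0_imp_concave[where f' = cos and f'' = "\<lambda>x. - sin x"])
       (auto intro!: derivative_eq_intros sin_ge_zero)
  from concave_onD_Icc'[OF this, of "\<theta> / 2"] assms have "\<theta> / pi \<le> sin (\<theta> / 2)"
    by (simp add: field_simps)
  then have "(\<theta> / pi)\<^sup>2 \<le> (sin (\<theta> / 2))\<^sup>2"
    using assms by (intro power_mono) auto
  then show ?thesis
    using cos_double_sin[of "\<theta> / 2"] by simp
qed

text \<open>
  A Gaussian replaces the exact exponential because its odd moments have explicit antiderivatives.
\<close>
lemma damped_integral_bound:
  assumes t: "0 \<le> t" and a: "a = 4 * t / pi\<^sup>2"
    and I: "((\<lambda>\<theta>. exp (- (2 * t * (1 - cos \<theta>))) * w \<theta>) has_integral I) {0..pi}"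
    and J: "((\<lambda>\<theta>. exp (- (a * \<theta>\<^sup>2)) * h \<theta>) has_integral J) {0..pi}"
    and w: "\<And>\<theta>. 0 \<le> \<theta> \<Longrightarrow> \<theta> \<le> pi \<Longrightarrow> \<bar>w \<theta>\<bar> \<le> h \<theta>"
  shows "\<bar>I\<bar> \<le> J"
proof -
  have "norm (integral {0..pi} (\<lambda>\<theta>. exp (- (2 * t * (1 - cos \<theta>))) * w \<theta>)) \<le>
      integral {0..pi} (\<lambda>\<theta>. exp (- (a * \<theta>\<^sup>2)) * h \<theta>)"
  proof (rule integral_norm_bound_integral)
    fix \<theta> assume "\<theta> \<in> {0..pi}"
    then have \<theta>: "0 \<le> \<theta>" "\<theta> \<le> pi"
      by auto
    have "2 * t * (2 * (\<theta> / pi)\<^sup>2) \<le> 2 * t * (1 - cos \<theta>)"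
      using t one_minus_cos_lower_bound[OF \<theta>] by (intro mult_left_mono) auto
    then have "exp (- (2 * t * (1 - cos \<theta>))) \<le> exp (- (a * \<theta>\<^sup>2))"
      by (simp add: a power_divide)
    then show "norm (exp (- (2 * t * (1 - cos \<theta>))) * w \<theta>) \<le> exp (- (a * \<theta>\<^sup>2)) * h \<theta>"
      unfolding norm_mult using w[OF \<theta>] by (intro mult_mono) auto
  qed (use I J in \<open>auto intro: has_integral_integrable\<close>)
  with I J show ?thesis
    by (simp add: integral_unique)
qed

text \<open>
  A factor vanishing to first order at \<open>\<theta> = 0\<close> gains \<open>1/t\<close>, since \<open>\<theta>\<close> has size \<open>1/sqrt t\<close> under the
  Gaussian and the integral runs over a range of that length.
\<close>
lemma damped_integral_bound_linear:
  assumes t: "0 < t" and I: "((\<lambda>\<theta>. exp (- (2 * t * (1 - cos \<theta>))) * w \<theta>) has_integral pi * I) {0..pi}"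
    and w: "\<And>\<theta>. 0 \<le> \<theta> \<Longrightarrow> \<theta> \<le> pi \<Longrightarrow> \<bar>w \<theta>\<bar> \<le> K * \<theta>"
  shows "\<bar>I\<bar> \<le> K / (2 * t)"
proof -
  define a where "a = 4 * t / pi\<^sup>2"
  have a: "a > 0"
    using t by (simp add: a_def)
  have "0 \<le> K * pi"
    by (rule order_trans[OF abs_ge_zero w]) auto
  then have K: "0 \<le> K"
    using pi_gt_zero by (auto simp: zero_le_mult_iff zero_le_power)
  have "((\<lambda>\<theta>. exp (- (a * \<theta>\<^sup>2)) * (K * \<theta>)) has_integral
      - (K / (2 * a)) * exp (- (a * pi\<^sup>2)) - - (K / (2 * a)) * exp (- (a * 0\<^sup>2))) {0..pi}"
  proof (rule fundamental_theorem_of_calculus)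
    fix \<theta>
    show "((\<lambda>\<theta>. - (K / (2 * a)) * exp (- (a * \<theta>\<^sup>2))) has_vector_derivative exp (- (a * \<theta>\<^sup>2)) * (K * \<theta>))
        (at \<theta> within {0..pi})"
      unfolding has_real_derivative_iff_has_vector_derivative[symmetric]
      using a by (auto intro!: derivative_eq_intros simp: field_simps)
  qed simp
  from damped_integral_bound[OF _ a_def I this w] t
  have "pi * \<bar>I\<bar> \<le> K / (2 * a) * (1 - exp (- (a * pi\<^sup>2)))"
    by (simp add: abs_mult algebra_simps)
  also have "\<dots> \<le> K / (2 * a) * 1"
    using K a by (intro mult_left_mono) auto
  also have "\<dots> = pi * (pi * K / (8 * t))"
    by (simp add: a_def power2_eq_square)
  finally have "\<bar>I\<bar> \<le> pi * K / (8 * t)"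
    by (simp only: mult_le_cancel_left_pos[OF pi_gt_zero])
  also have "\<dots> \<le> 4 * K / (8 * t)"
    using pi_less_4 K t by (intro divide_right_mono mult_right_mono) auto
  finally show ?thesis
    by simp
qed

text \<open>
  By the same scaling, a factor vanishing to third order gains \<open>1/t\<^sup>2\<close>.
\<close>
lemma damped_integral_bound_cubic:
  assumes t: "0 < t" and I: "((\<lambda>\<theta>. exp (- (2 * t * (1 - cos \<theta>))) * w \<theta>) has_integral pi * I) {0..pi}"
    and w: "\<And>\<theta>. 0 \<le> \<theta> \<Longrightarrow> \<theta> \<le> pi \<Longrightarrow> \<bar>w \<theta>\<bar> \<le> K * \<theta> ^ 3"
  shows "\<bar>I\<bar> \<le> 2 * K / t\<^sup>2"
proof -
  define a where "a = 4 * t / pi\<^sup>2"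
  have a: "a > 0"
    using t by (simp add: a_def)
  have "0 \<le> K * pi ^ 3"
    by (rule order_trans[OF abs_ge_zero w]) auto
  then have K: "0 \<le> K"
    using pi_gt_zero by (auto simp: zero_le_mult_iff zero_le_power)
  have "((\<lambda>\<theta>. exp (- (a * \<theta>\<^sup>2)) * (K * \<theta> ^ 3)) has_integral
      - (K / (2 * a\<^sup>2)) * ((1 + a * pi\<^sup>2) * exp (- (a * pi\<^sup>2))) -
      - (K / (2 * a\<^sup>2)) * ((1 + a * 0\<^sup>2) * exp (- (a * 0\<^sup>2)))) {0..pi}"
  proof (rule fundamental_theorem_of_calculus)
    fix \<theta>
    show "((\<lambda>\<theta>. - (K / (2 * a\<^sup>2)) * ((1 + a * \<theta>\<^sup>2) * exp (- (a * \<theta>\<^sup>2)))) has_vector_derivative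
        exp (- (a * \<theta>\<^sup>2)) * (K * \<theta> ^ 3)) (at \<theta> within {0..pi})"
      unfolding has_real_derivative_iff_has_vector_derivative[symmetric]
      using a by (auto intro!: derivative_eq_intros simp: field_simps power2_eq_square power3_eq_cube)
  qed simp
  from damped_integral_bound[OF _ a_def I this w] t
  have "pi * \<bar>I\<bar> \<le> K / (2 * a\<^sup>2) * (1 - (1 + a * pi\<^sup>2) * exp (- (a * pi\<^sup>2)))"
    by (simp add: abs_mult algebra_simps)
  also have "\<dots> \<le> K / (2 * a\<^sup>2) * 1"
    using K a by (intro mult_left_mono) auto
  also have "\<dots> = pi * (pi ^ 3 * K / (32 * t\<^sup>2))"
    by (simp add: a_def power2_eq_square power3_eq_cube)
  finally have "\<bar>I\<bar> \<le> pi ^ 3 * K / (32 * t\<^sup>2)"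
    by (simp only: mult_le_cancel_left_pos[OF pi_gt_zero])
  also have "\<dots> \<le> 4 ^ 3 * K / (32 * t\<^sup>2)"
    using pi_less_4 K t by (intro divide_right_mono mult_right_mono power_mono) auto
  finally show ?thesis
    by simp
qed

lemma abs_heat_kernel_le_1:
  assumes "0 \<le> t"
  shows "\<bar>heat_kernel t j\<bar> \<le> 1"
proof -
  have "norm (integral {0..pi} (\<lambda>\<theta>. exp (- (2 * t * (1 - cos \<theta>))) * cos (of_int j * \<theta>))) \<le>
      integral {0..pi} (\<lambda>\<theta>. 1)"
  proof (rule integral_norm_bound_integral)
    fix \<theta> :: real
    have "exp (- (2 * t * (1 - cos \<theta>))) * \<bar>cos (of_int j * \<theta>)\<bar> \<le> 1 * 1"
      using assms by (intro mult_mono) auto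
    then show "norm (exp (- (2 * t * (1 - cos \<theta>))) * cos (of_int j * \<theta>)) \<le> 1"
      by (simp add: abs_mult)
  qed (use heat_kernel_integral[of t j] in \<open>auto intro: has_integral_integrable\<close>)
  then show ?thesis
    using heat_kernel_integral[of t j] by (simp add: integral_unique abs_mult)
qed

lemma abs_cos_diff_le: "\<bar>cos x - cos y\<bar> \<le> \<bar>x - y\<bar>" for x y :: real
proof -
  have "\<bar>cos x - cos y\<bar> \<le> 2 * (1 * \<bar>sin ((y - x) / 2)\<bar>)"
    unfolding cos_diff_cos abs_mult mult.assoc by (intro mult_mono) auto
  also have "\<dots> \<le> 2 * (1 * \<bar>(y - x) / 2\<bar>)"
    by (intro mult_mono abs_sin_x_le_abs_x) auto
  finally show ?thesis
    by simp
qed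

text \<open>
  In Fourier terms the central difference is multiplication by a factor of size at most \<open>2 \<theta>\<close>.
\<close>
lemma heat_kernel_central_difference_bound:
  assumes "0 < t"
  shows "t * \<bar>heat_kernel t (j - 1) - heat_kernel t (j + 1)\<bar> \<le> 1"
proof -
  have "((\<lambda>\<theta>. exp (- (2 * t * (1 - cos \<theta>))) * (2 * (sin \<theta> * sin (of_int j * \<theta>)))) has_integral
      pi * (heat_kernel t (j - 1) - heat_kernel t (j + 1))) {0..pi}"
    using has_integral_diff[OF heat_kernel_integral[of t "j - 1"] heat_kernel_integral[of t "j + 1"]]
    by (simp add: algebra_simps cos_add cos_diff)
  moreover have "\<bar>2 * (sin \<theta> * sin (of_int j * \<theta>))\<bar> \<le> 2 * \<theta>" if "0 \<le> \<theta>" for \<theta> :: real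
  proof -
    have "\<bar>sin \<theta>\<bar> * \<bar>sin (of_int j * \<theta>)\<bar> \<le> \<bar>\<theta>\<bar> * 1"
      by (intro mult_mono abs_sin_x_le_abs_x) auto
    with that show ?thesis
      by (simp add: abs_mult)
  qed
  ultimately have "\<bar>heat_kernel t (j - 1) - heat_kernel t (j + 1)\<bar> \<le> 2 / (2 * t)"
    by (rule damped_integral_bound_linear[OF assms])
  with assms show ?thesis
    by (simp add: field_simps)
qed

lemma heat_kernel_difference_bound:
  assumes "0 < t"
  shows "t * \<bar>heat_kernel t j - heat_kernel t (j + 1)\<bar> \<le> 1"
proof -
  have "((\<lambda>\<theta>. exp (- (2 * t * (1 - cos \<theta>))) * (cos (of_int j * \<theta>) - cos (of_int (j + 1) * \<theta>))) has_integral
      pi * (heat_kernel t j - heat_kernel t (j + 1))) {0..pi}"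
    using has_integral_diff[OF heat_kernel_integral[of t j] heat_kernel_integral[of t "j + 1"]]
    by (simp add: right_diff_distrib)
  moreover have "\<bar>cos (of_int j * \<theta>) - cos (of_int (j + 1) * \<theta>)\<bar> \<le> 1 * \<theta>" if "0 \<le> \<theta>" for \<theta> :: real
    using abs_cos_diff_le[of "of_int j * \<theta>" "of_int (j + 1) * \<theta>"] that by (simp add: algebra_simps)
  ultimately have "\<bar>heat_kernel t j - heat_kernel t (j + 1)\<bar> \<le> 1 / (2 * t)"
    by (rule damped_integral_bound_linear[OF assms])
  with assms show ?thesis
    by (simp add: field_simps)
qed

lemma second_central_difference_integral:
  "((\<lambda>\<theta>. exp (- (2 * t * (1 - cos \<theta>))) * (- 4 * (sin \<theta>)\<^sup>2 * cos (of_int j * \<theta>))) has_integral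
      pi * (heat_kernel t (j - 2) - 2 * heat_kernel t j + heat_kernel t (j + 2))) {0..pi}"
proof -
  have double: "cos (of_int (j - 2) * \<theta>) - 2 * cos (of_int j * \<theta>) + cos (of_int (j + 2) * \<theta>) =
      - 4 * (sin \<theta>)\<^sup>2 * cos (of_int j * \<theta>)" for \<theta> :: real
  proof -
    have "of_int (j - 2) * \<theta> = of_int j * \<theta> - 2 * \<theta>" "of_int (j + 2) * \<theta> = of_int j * \<theta> + 2 * \<theta>"
      by (simp_all add: algebra_simps)
    then show ?thesis
      by (simp add: cos_add cos_diff cos_double_sin) (simp add: algebra_simps)
  qed
  let ?E = "\<lambda>\<theta>::real. exp (- (2 * t * (1 - cos \<theta>)))"
  have "((\<lambda>\<theta>. ?E \<theta> * cos (of_int (j - 2) * \<theta>) - 2 * (?E \<theta> * cos (of_int j * \<theta>)) + ?E \<theta> * cos (of_int (j + 2) * \<theta>))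
      has_integral pi * heat_kernel t (j - 2) - 2 * (pi * heat_kernel t j) + pi * heat_kernel t (j + 2)) {0..pi}"
    by (intro has_integral_add has_integral_diff has_integral_mult_right heat_kernel_integral)
  moreover have "?E \<theta> * cos (of_int (j - 2) * \<theta>) - 2 * (?E \<theta> * cos (of_int j * \<theta>)) + ?E \<theta> * cos (of_int (j + 2) * \<theta>) =
      ?E \<theta> * (- 4 * (sin \<theta>)\<^sup>2 * cos (of_int j * \<theta>))" for \<theta>
    unfolding double[symmetric] by (simp add: algebra_simps)
  moreover have "pi * heat_kernel t (j - 2) - 2 * (pi * heat_kernel t j) + pi * heat_kernel t (j + 2) =
      pi * (heat_kernel t (j - 2) - 2 * heat_kernel t j + heat_kernel t (j + 2))"
    by (simp add: algebra_simps)
  ultimately show ?thesis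
    by (simp only:)
qed

text \<open>
  Each of the three differences supplies one factor \<open>\<theta>\<close>. The increment \<open>k = 1\<close> enters the bound for
  \<open>j\<^sup>2 \<delta>G\<close>, and \<open>k = 2\<close>, the third central difference, the one for \<open>j\<^sup>3 G\<close>.
\<close>
lemma second_central_difference_increment_bound:
  assumes t: "0 < t" and k: "0 \<le> k"
  defines "D2 \<equiv> \<lambda>j. heat_kernel t (j - 2) - 2 * heat_kernel t j + heat_kernel t (j + 2)"
  shows "t\<^sup>2 * \<bar>D2 j - D2 (j + k)\<bar> \<le> 8 * of_int k"
proof -
  have "((\<lambda>\<theta>. exp (- (2 * t * (1 - cos \<theta>))) *
        (4 * (sin \<theta>)\<^sup>2 * (cos (of_int (j + k) * \<theta>) - cos (of_int j * \<theta>)))) has_integral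
      pi * (D2 j - D2 (j + k))) {0..pi}"
    using has_integral_diff[OF second_central_difference_integral[of t j]
        second_central_difference_integral[of t "j + k"]]
    unfolding D2_def by (simp add: right_diff_distrib mult.assoc)
  moreover have "\<bar>4 * (sin \<theta>)\<^sup>2 * (cos (of_int (j + k) * \<theta>) - cos (of_int j * \<theta>))\<bar> \<le> (4 * of_int k) * \<theta> ^ 3"
    if "0 \<le> \<theta>" for \<theta> :: real
  proof -
    have "\<bar>sin \<theta>\<bar> ^ 2 * \<bar>cos (of_int (j + k) * \<theta>) - cos (of_int j * \<theta>)\<bar> \<le>
        \<bar>\<theta>\<bar> ^ 2 * \<bar>of_int (j + k) * \<theta> - of_int j * \<theta>\<bar>"
      by (intro mult_mono power_mono abs_sin_x_le_abs_x abs_cos_diff_le) auto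
    also have "\<dots> = of_int k * \<theta> ^ 3"
      using that k by (simp add: algebra_simps abs_mult power2_eq_square power3_eq_cube)
    finally show ?thesis
      by (simp add: abs_mult)
  qed
  ultimately have "\<bar>D2 j - D2 (j + k)\<bar> \<le> 2 * (4 * of_int k) / t\<^sup>2"
    by (rule damped_integral_bound_cubic[OF t])
  with t show ?thesis
    by (simp add: field_simps)
qed

text \<open>
  The recurrence applied twice: the second factor \<open>j\<close> has to be shifted to \<open>j - 1\<close> and \<open>j + 1\<close> before
  it can act on the neighbours, and the shifts produce the term of lower order.
\<close>
lemma square_times_heat_kernel:
  "(of_int j)\<^sup>2 * heat_kernel t j =
     t\<^sup>2 * (heat_kernel t (j - 2) - 2 * heat_kernel t j + heat_kernel t (j + 2)) +
     t * (heat_kernel t (j - 1) + heat_kernel t (j + 1))"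
proof -
  have "of_int (j - 1) * heat_kernel t (j - 1) = t * (heat_kernel t (j - 2) - heat_kernel t j)"
    "of_int (j + 1) * heat_kernel t (j + 1) = t * (heat_kernel t j - heat_kernel t (j + 2))"
    using heat_kernel_recurrence[of "j - 1" t] heat_kernel_recurrence[of "j + 1" t] by (simp_all add: add.commute)
  then have 1: "of_int j * heat_kernel t (j - 1) = t * (heat_kernel t (j - 2) - heat_kernel t j) + heat_kernel t (j - 1)"
    "of_int j * heat_kernel t (j + 1) = t * (heat_kernel t j - heat_kernel t (j + 2)) - heat_kernel t (j + 1)"
    by (simp_all add: algebra_simps)
  have "(of_int j)\<^sup>2 * heat_kernel t j = of_int j * (of_int j * heat_kernel t j)"
    by (simp add: power2_eq_square)
  also have "\<dots> = t * (of_int j * heat_kernel t (j - 1) - of_int j * heat_kernel t (j + 1))"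
    unfolding heat_kernel_recurrence[of j] by (simp add: algebra_simps)
  also have "\<dots> = t\<^sup>2 * (heat_kernel t (j - 2) - 2 * heat_kernel t j + heat_kernel t (j + 2)) +
     t * (heat_kernel t (j - 1) + heat_kernel t (j + 1))"
    unfolding 1 by (simp add: algebra_simps power2_eq_square)
  finally show ?thesis .
qed

lemma abs_index_times_heat_kernel_bound:
  assumes "0 < t"
  shows "\<bar>of_int j\<bar> * \<bar>heat_kernel t j\<bar> \<le> 1"
  using heat_kernel_central_difference_bound[OF assms, of j] heat_kernel_recurrence[of j t] assms
  by (simp add: abs_mult flip: abs_mult[of "of_int j"])

text \<open>
  Subtracting the identities for \<open>j\<^sup>2 G(t,j)\<close> and \<open>(j+1)\<^sup>2 G(t,j+1)\<close> leaves a third difference times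
  \<open>t\<^sup>2\<close>, first differences times \<open>t\<close>, and \<open>G\<close> itself, all of which are bounded.
\<close>
lemma square_times_difference_bound:
  assumes t: "0 < t"
  shows "(of_int j)\<^sup>2 * \<bar>heat_kernel t j - heat_kernel t (j + 1)\<bar> \<le> 13"
proof -
  define g where "g = heat_kernel t"
  define D2 where "D2 = (\<lambda>j. g (j - 2) - 2 * g j + g (j + 2))"
  have sq: "(of_int i)\<^sup>2 * g i = t\<^sup>2 * D2 i + t * (g (i - 1) + g (i + 1))" for i
    using square_times_heat_kernel[of i t] by (simp add: g_def D2_def)
  have rec: "of_int (j + 1) * g (j + 1) = t * (g j - g (j + 2))"
    using heat_kernel_recurrence[of "j + 1" t] by (simp add: g_def add.commute)
  have "(of_int (j + 1))\<^sup>2 = (of_int j)\<^sup>2 + 2 * of_int (j + 1) - (1::real)"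
    by (simp add: power2_eq_square algebra_simps)
  then have "(of_int j)\<^sup>2 * g (j + 1) = (of_int (j + 1))\<^sup>2 * g (j + 1) - 2 * (of_int (j + 1) * g (j + 1)) + g (j + 1)"
    by (simp add: algebra_simps)
  then have "(of_int j)\<^sup>2 * (g j - g (j + 1)) =
      t\<^sup>2 * (D2 j - D2 (j + 1)) + t * (g (j - 1) - g j) + t * (g (j + 1) - g (j + 2)) +
      2 * (t * (g j - g (j + 2))) - g (j + 1)"
    using sq[of j] sq[of "j + 1"] unfolding rec by (simp add: algebra_simps)
  moreover have "\<bar>t\<^sup>2 * (D2 j - D2 (j + 1))\<bar> \<le> 8"
    using second_central_difference_increment_bound[OF t, of 1 j] by (simp add: D2_def g_def abs_mult)
  moreover have "\<bar>t * (g (j - 1) - g j)\<bar> \<le> 1"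
    using heat_kernel_difference_bound[OF t, of "j - 1"] t by (simp add: g_def abs_mult)
  moreover have "\<bar>t * (g (j + 1) - g (j + 2))\<bar> \<le> 1"
    using heat_kernel_difference_bound[OF t, of "j + 1"] t by (simp add: g_def abs_mult add.commute)
  moreover have "\<bar>t * (g j - g (j + 2))\<bar> \<le> 1"
    using heat_kernel_central_difference_bound[OF t, of "j + 1"] t by (simp add: g_def abs_mult add.commute)
  moreover have "\<bar>g (j + 1)\<bar> \<le> 1"
    using abs_heat_kernel_le_1[of t] t by (simp add: g_def)
  ultimately have "\<bar>(of_int j)\<^sup>2 * (g j - g (j + 1))\<bar> \<le> 13"
    by linarith
  then show ?thesis
    by (simp add: g_def abs_mult)
qed

text \<open>
  One more application of the recurrence to \<open>j\<^sup>2 G(t,j)\<close>. After a factor \<open>t\<close> is taken out, what is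
  left is again a third difference times \<open>t\<^sup>2\<close>, first differences times \<open>t\<close>, and values of \<open>G\<close>.
\<close>
lemma cube_times_heat_kernel_bound:
  assumes t: "0 < t"
  shows "\<bar>of_int j\<bar> ^ 3 * \<bar>heat_kernel t j\<bar> \<le> 24 * t"
proof -
  define g where "g = heat_kernel t"
  define D2 where "D2 = (\<lambda>j. g (j - 2) - 2 * g j + g (j + 2))"
  have sq: "(of_int i)\<^sup>2 * g i = t\<^sup>2 * D2 i + t * (g (i - 1) + g (i + 1))" for i
    using square_times_heat_kernel[of i t] by (simp add: g_def D2_def)
  have rec: "of_int i * g i = t * (g (i - 1) - g (i + 1))" for i
    using heat_kernel_recurrence[of i t] by (simp add: g_def)
  have shift: "(of_int (j - 1))\<^sup>2 = (of_int j)\<^sup>2 - 2 * of_int (j - 1) - (1::real)"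
    "(of_int (j + 1))\<^sup>2 = (of_int j)\<^sup>2 + 2 * of_int (j + 1) - (1::real)"
    by (simp_all add: power2_eq_square algebra_simps)
  have left: "(of_int j)\<^sup>2 * g (j - 1) = t\<^sup>2 * D2 (j - 1) + t * (g (j - 2) + g j) + 2 * (t * (g (j - 2) - g j)) + g (j - 1)"
    using sq[of "j - 1"] rec[of "j - 1"] unfolding shift by (simp add: algebra_simps)
  have right: "(of_int j)\<^sup>2 * g (j + 1) = t\<^sup>2 * D2 (j + 1) + t * (g j + g (j + 2)) - 2 * (t * (g j - g (j + 2))) + g (j + 1)"
    using sq[of "j + 1"] rec[of "j + 1"] unfolding shift by (simp add: algebra_simps)
  have "of_int j ^ 3 * g j = (of_int j)\<^sup>2 * (of_int j * g j)"
    by (simp add: power2_eq_square power3_eq_cube)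
  also have "\<dots> = t * ((of_int j)\<^sup>2 * g (j - 1) - (of_int j)\<^sup>2 * g (j + 1))"
    unfolding rec[of j] by (simp add: algebra_simps)
  also have "\<dots> = t * (t\<^sup>2 * (D2 (j - 1) - D2 (j + 1)) + 3 * (t * (g (j - 2) - g j)) + 3 * (t * (g j - g (j + 2))) +
      (g (j - 1) - g (j + 1)))"
    unfolding left right by (simp add: algebra_simps)
  finally have eq: "of_int j ^ 3 * g j = \<dots>" .
  have "\<bar>t\<^sup>2 * (D2 (j - 1) - D2 (j + 1))\<bar> \<le> 16"
    using second_central_difference_increment_bound[OF t, of 2 "j - 1"]
    by (simp add: D2_def g_def abs_mult add.commute)
  moreover have "\<bar>t * (g (j - 2) - g j)\<bar> \<le> 1" "\<bar>t * (g j - g (j + 2))\<bar> \<le> 1"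
    using heat_kernel_central_difference_bound[OF t, of "j - 1"] heat_kernel_central_difference_bound[OF t, of "j + 1"] t
    by (simp_all add: g_def abs_mult add.commute)
  moreover have "\<bar>g (j - 1)\<bar> \<le> 1" "\<bar>g (j + 1)\<bar> \<le> 1"
    using abs_heat_kernel_le_1[of t] t by (simp_all add: g_def)
  ultimately have "\<bar>t\<^sup>2 * (D2 (j - 1) - D2 (j + 1)) + 3 * (t * (g (j - 2) - g j)) + 3 * (t * (g j - g (j + 2))) +
      (g (j - 1) - g (j + 1))\<bar> \<le> 24"
    by linarith
  then have "\<bar>of_int j ^ 3 * g j\<bar> \<le> t * 24"
    unfolding eq abs_mult[of t] using t by (intro mult_mono) auto
  then show ?thesis
    by (simp add: g_def abs_mult power_abs)
qed

lemma heat_kernel_measurable [measurable]: "(\<lambda>t. heat_kernel t j) \<in> borel_measurable borel"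
  unfolding heat_kernel_def bessel_I_def Let_def by measurable

section \<open>Differentiation under the integral sign\<close>

text \<open>
  By the mean value theorem the bound on the derivative dominates all difference quotients, so
  dominated convergence applies along every sequence tending to \<open>y\<^sub>0\<close>.
\<close>
lemma has_real_derivative_integral_dominated:
  fixes f f' :: "real \<Rightarrow> 'a \<Rightarrow> real"
  assumes d: "0 < d"
    and f: "\<And>y. \<bar>y - y\<^sub>0\<bar> < d \<Longrightarrow> integrable M (f y)"
    and f'[measurable]: "f' y\<^sub>0 \<in> borel_measurable M"
    and deriv: "\<And>t y. t \<in> space M \<Longrightarrow> \<bar>y - y\<^sub>0\<bar> < d \<Longrightarrow> ((\<lambda>y. f y t) has_real_derivative f' y t) (at y)"
    and bound: "\<And>t y. t \<in> space M \<Longrightarrow> \<bar>y - y\<^sub>0\<bar> < d \<Longrightarrow> \<bar>f' y t\<bar> \<le> g t"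
    and g: "integrable M g"
  shows "((\<lambda>y. integral\<^sup>L M (f y)) has_real_derivative integral\<^sup>L M (f' y\<^sub>0)) (at y\<^sub>0)"
  unfolding has_field_derivative_iff tendsto_at_iff_sequentially comp_def
proof (intro allI impI)
  fix Y :: "nat \<Rightarrow> real"
  assume Y: "\<forall>i. Y i \<in> UNIV - {y\<^sub>0}" "Y \<longlonglongrightarrow> y\<^sub>0"
  then have "\<forall>\<^sub>F n in sequentially. dist (Y n) y\<^sub>0 < d"
    using d by (simp add: tendstoD)
  then obtain N where N: "\<And>n. n \<ge> N \<Longrightarrow> \<bar>Y n - y\<^sub>0\<bar> < d"
    by (auto simp: eventually_sequentially dist_real_def)
  define s where "s n t = (f (Y (n + N)) t - f y\<^sub>0 t) / (Y (n + N) - y\<^sub>0)" for n t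
  have "(\<lambda>n. integral\<^sup>L M (s n)) \<longlonglongrightarrow> integral\<^sup>L M (f' y\<^sub>0)"
  proof (rule integral_dominated_convergence[OF f' _ g])
    show "s n \<in> borel_measurable M" for n
    proof -
      have [measurable]: "f (Y (n + N)) \<in> borel_measurable M" "f y\<^sub>0 \<in> borel_measurable M"
        using f[of "Y (n + N)"] f[of y\<^sub>0] N[of "n + N"] d by (auto simp: borel_measurable_integrable)
      show ?thesis
        unfolding s_def by measurable
    qed
    show "AE t in M. (\<lambda>n. s n t) \<longlonglongrightarrow> f' y\<^sub>0 t"
    proof (rule AE_I2)
      fix t assume "t \<in> space M"
      then have "((\<lambda>y. f y t) has_real_derivative f' y\<^sub>0 t) (at y\<^sub>0)"
        using deriv d by simp
      with Y have "(\<lambda>n. (f (Y n) t - f y\<^sub>0 t) / (Y n - y\<^sub>0)) \<longlonglongrightarrow> f' y\<^sub>0 t"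
        unfolding has_field_derivative_iff tendsto_at_iff_sequentially comp_def by blast
      then show "(\<lambda>n. s n t) \<longlonglongrightarrow> f' y\<^sub>0 t"
        unfolding s_def by (rule LIMSEQ_ignore_initial_segment)
    qed
    show "AE t in M. norm (s n t) \<le> g t" for n
    proof (rule AE_I2)
      fix t assume t: "t \<in> space M"
      have "norm (f (Y (n + N)) t - f y\<^sub>0 t) \<le> g t * norm (Y (n + N) - y\<^sub>0)"
      proof (rule field_differentiable_bound[where S = "ball y\<^sub>0 d" and f' = "\<lambda>y. f' y t"])
        show "((\<lambda>y. f y t) has_field_derivative f' y t) (at y within ball y\<^sub>0 d)" if "y \<in> ball y\<^sub>0 d" for y
          using deriv[OF t, of y] that by (simp add: dist_real_def abs_minus_commute has_field_derivative_at_within)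
        show "norm (f' y t) \<le> g t" if "y \<in> ball y\<^sub>0 d" for y
          using bound[OF t, of y] that by (simp add: dist_real_def abs_minus_commute)
      qed (use N[of "n + N"] d in \<open>auto simp: dist_real_def abs_minus_commute\<close>)
      moreover have "Y (n + N) \<noteq> y\<^sub>0"
        using Y by simp
      ultimately show "norm (s n t) \<le> g t"
        by (simp add: s_def divide_simps)
    qed
  qed
  moreover have "integral\<^sup>L M (s n) = (integral\<^sup>L M (f (Y (n + N))) - integral\<^sup>L M (f y\<^sub>0)) / (Y (n + N) - y\<^sub>0)" for n
    unfolding s_def using f[of "Y (n + N)"] f[of y\<^sub>0] N[of "n + N"] d by simp
  ultimately have "(\<lambda>n. (integral\<^sup>L M (f (Y (n + N))) - integral\<^sup>L M (f y\<^sub>0)) / (Y (n + N) - y\<^sub>0)) \<longlonglongrightarrow>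
      integral\<^sup>L M (f' y\<^sub>0)"
    by (simp only:)
  then show "(\<lambda>n. (integral\<^sup>L M (f (Y n)) - integral\<^sup>L M (f y\<^sub>0)) / (Y n - y\<^sub>0)) \<longlonglongrightarrow> integral\<^sup>L M (f' y\<^sub>0)"
    by (rule LIMSEQ_offset)
qed

section \<open>Derivatives of the subordination kernel\<close>

text \<open>
  The \<open>l\<close>-th \<open>y\<close>-derivative of \<open>y exp(-c y\<^sup>2/t)\<close> has the form \<open>y / y ^ l * p u * exp (-c u)\<close> with
  \<open>u = y\<^sup>2/t\<close>. The recursion is what one further differentiation does to \<open>p\<close>: the prefactor contributes
  \<open>(1 - l) p\<close>, and the chain rule, with \<open>y (du/dy) = 2 u\<close>, contributes \<open>2 u (p' - c p)\<close>.
\<close>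
primrec kernel_poly :: "real \<Rightarrow> nat \<Rightarrow> real poly" where
  "kernel_poly c 0 = 1"
| "kernel_poly c (Suc l) = smult (1 - real l) (kernel_poly c l) +
     [:0, 2:] * (pderiv (kernel_poly c l) - smult c (kernel_poly c l))"

definition kernel_deriv :: "real \<Rightarrow> nat \<Rightarrow> real \<Rightarrow> real \<Rightarrow> real" where
  "kernel_deriv c l y t = y / y ^ l * (poly (kernel_poly c l) (y\<^sup>2 / t) * exp (- c * y\<^sup>2 / t))"

lemma kernel_deriv_has_derivative:
  assumes "y \<noteq> 0" "t \<noteq> 0"
  shows "((\<lambda>y. kernel_deriv c l y t) has_real_derivative kernel_deriv c (Suc l) y t) (at y)"
proof -
  define p where "p = kernel_poly c l"
  have 1: "((\<lambda>y. y / y ^ l) has_real_derivative (1 - real l) / y ^ l) (at y)"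
  proof -
    have "y * (real l * y ^ (l - 1)) = real l * y ^ l"
      by (cases l) auto
    then have "(1 * y ^ l - y * (real l * y ^ (l - 1))) / (y ^ l * y ^ l) = (1 - real l) / y ^ l"
      using assms by (simp add: field_simps)
    with assms show ?thesis
      by (auto intro!: derivative_eq_intros)
  qed
  have 2: "((\<lambda>y. poly p (y\<^sup>2 / t)) has_real_derivative poly (pderiv p) (y\<^sup>2 / t) * (2 * y / t)) (at y)"
  proof (rule DERIV_chain2[OF poly_DERIV])
    show "((\<lambda>y. y\<^sup>2 / t) has_real_derivative 2 * y / t) (at y)"
      using assms by (auto intro!: derivative_eq_intros)
  qed
  have 3: "((\<lambda>y. exp (- c * y\<^sup>2 / t)) has_real_derivative exp (- c * y\<^sup>2 / t) * (- c * (2 * y / t))) (at y)"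
  proof (rule DERIV_chain2[OF DERIV_exp])
    show "((\<lambda>y. - c * y\<^sup>2 / t) has_real_derivative - c * (2 * y / t)) (at y)"
      using assms by (auto intro!: derivative_eq_intros)
  qed
  have "((\<lambda>y. y / y ^ l * (poly p (y\<^sup>2 / t) * exp (- c * y\<^sup>2 / t))) has_real_derivative
      (1 - real l) / y ^ l * (poly p (y\<^sup>2 / t) * exp (- c * y\<^sup>2 / t)) +
      (poly (pderiv p) (y\<^sup>2 / t) * (2 * y / t) * exp (- c * y\<^sup>2 / t) +
       exp (- c * y\<^sup>2 / t) * (- c * (2 * y / t)) * poly p (y\<^sup>2 / t)) * (y / y ^ l)) (at y)"
    by (intro DERIV_mult 1 2 3)
  moreover have "(1 - real l) / y ^ l * (poly p (y\<^sup>2 / t) * exp (- c * y\<^sup>2 / t)) +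
      (poly (pderiv p) (y\<^sup>2 / t) * (2 * y / t) * exp (- c * y\<^sup>2 / t) +
       exp (- c * y\<^sup>2 / t) * (- c * (2 * y / t)) * poly p (y\<^sup>2 / t)) * (y / y ^ l) = kernel_deriv c (Suc l) y t"
    unfolding kernel_deriv_def p_def[symmetric] kernel_poly.simps
    using assms by (simp add: power2_eq_square field_simps add_divide_distrib)
  ultimately show ?thesis
    unfolding kernel_deriv_def p_def by simp
qed

lemma poly_exp_bound:
  fixes p :: "real poly"
  assumes "0 < e"
  shows "\<exists>B\<ge>0. \<forall>u\<ge>0. \<bar>poly p u\<bar> \<le> B * exp (e * u)"
  using assms
proof (induction p arbitrary: e)
  case 0
  then show ?case by auto
next
  case (pCons a p)
  from pCons.IH[of "e / 2"] pCons.prems obtain B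
    where B: "B \<ge> 0" "\<And>u. u \<ge> 0 \<Longrightarrow> \<bar>poly p u\<bar> \<le> B * exp (e / 2 * u)"
    by auto
  have "\<bar>poly (pCons a p) u\<bar> \<le> (\<bar>a\<bar> + 2 * B / e) * exp (e * u)" if u: "u \<ge> 0" for u
  proof -
    have "e / 2 * u \<le> exp (e / 2 * u)"
      using exp_ge_add_one_self[of "e / 2 * u"] by linarith
    then have "u \<le> 2 / e * exp (e / 2 * u)"
      using pCons.prems by (simp add: field_simps)
    then have "u * \<bar>poly p u\<bar> \<le> 2 / e * exp (e / 2 * u) * (B * exp (e / 2 * u))"
      using B u pCons.prems by (intro mult_mono) auto
    also have "\<dots> = 2 * B / e * (exp (e / 2 * u) * exp (e / 2 * u))"
      by simp
    also have "exp (e / 2 * u) * exp (e / 2 * u) = exp (e * u)"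
      unfolding exp_add[symmetric] by simp
    finally have "u * \<bar>poly p u\<bar> \<le> 2 * B / e * exp (e * u)" .
    moreover have "\<bar>a\<bar> * 1 \<le> \<bar>a\<bar> * exp (e * u)"
      using pCons.prems u by (intro mult_left_mono) auto
    moreover have "\<bar>a + u * poly p u\<bar> \<le> \<bar>a\<bar> + u * \<bar>poly p u\<bar>"
      using abs_triangle_ineq[of a "u * poly p u"] u by (simp add: abs_mult)
    ultimately show ?thesis
      by (simp add: distrib_right)
  qed
  then show ?case
    using B pCons.prems by (intro exI[of _ "\<bar>a\<bar> + 2 * B / e"]) auto
qed

text \<open>
  Half of the exponential absorbs the polynomial; the other half is kept for the integration in \<open>t\<close>.
\<close>
lemma kernel_deriv_bound:
  assumes "0 < c"
  shows "\<exists>B\<ge>0. \<forall>y>0. \<forall>t>0. \<bar>kernel_deriv c l y t\<bar> \<le> B * (y / y ^ l) * exp (- (c / 2 * y\<^sup>2) / t)"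
proof -
  from poly_exp_bound[of "c / 2" "kernel_poly c l"] assms obtain B where
    B: "B \<ge> 0" "\<And>u. u \<ge> 0 \<Longrightarrow> \<bar>poly (kernel_poly c l) u\<bar> \<le> B * exp (c / 2 * u)"
    by auto
  have "\<bar>kernel_deriv c l y t\<bar> \<le> B * (y / y ^ l) * exp (- (c / 2 * y\<^sup>2) / t)" if y: "y > 0" "t > 0" for y t
  proof -
    have "\<bar>poly (kernel_poly c l) (y\<^sup>2 / t)\<bar> * exp (- c * y\<^sup>2 / t) \<le> B * exp (c / 2 * (y\<^sup>2 / t)) * exp (- c * y\<^sup>2 / t)"
      using y by (intro mult_right_mono B) auto
    also have "\<dots> = B * exp (- (c / 2 * y\<^sup>2) / t)"
      unfolding mult.assoc exp_add[symmetric] by (simp add: field_simps)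
    finally have "y / y ^ l * (\<bar>poly (kernel_poly c l) (y\<^sup>2 / t)\<bar> * exp (- c * y\<^sup>2 / t)) \<le>
        y / y ^ l * (B * exp (- (c / 2 * y\<^sup>2) / t))"
      using y by (intro mult_left_mono) auto
    then show ?thesis
      using y by (simp add: kernel_deriv_def abs_mult mult.commute mult.left_commute)
  qed
  with B show ?thesis
    by blast
qed

lemma kernel_deriv_measurable [measurable]: "kernel_deriv c l y \<in> borel_measurable borel"
proof -
  have [measurable]: "poly p \<in> borel_measurable borel" for p :: "real poly"
    by (intro borel_measurable_continuous_onI continuous_intros)
  show ?thesis
    unfolding kernel_deriv_def[abs_def] by measurable
qed

section \<open>Integrals of the kernel against functions of the time variable\<close>

text \<open>
  The antiderivative is \<open>2 / sqrt a * arctan (sqrt (t / a))\<close>.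
\<close>
lemma arctan_weight_integral:
  assumes "0 < a"
  shows "set_integrable lborel {0<..} (\<lambda>t. 1 / (sqrt t * (t + a)))"
    and "(LBINT t:{0<..}. 1 / (sqrt t * (t + a))) = pi / sqrt a"
proof -
  let ?F = "\<lambda>t. 2 / sqrt a * arctan (sqrt t / sqrt a)"
  have deriv: "(?F has_real_derivative 1 / (sqrt t * (t + a))) (at t)" if "t > 0" for t
  proof -
    have "1 + (sqrt t / sqrt a)\<^sup>2 = (t + a) / a"
      using assms that by (simp add: power_divide field_simps)
    moreover have "(?F has_real_derivative
        2 / sqrt a * (inverse (1 + (sqrt t / sqrt a)\<^sup>2) * (inverse (sqrt t) / 2 / sqrt a))) (at t)"
      by (intro DERIV_cmult DERIV_chain2[OF DERIV_arctan] DERIV_cdivide DERIV_real_sqrt that)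
    moreover have "2 / sqrt a * (inverse ((t + a) / a) * (inverse (sqrt t) / 2 / sqrt a)) = 1 / (sqrt t * (t + a))"
      using assms that by (simp add: divide_simps)
    ultimately show ?thesis
      by simp
  qed
  have cont: "isCont (\<lambda>t. 1 / (sqrt t * (t + a))) t" if "t > 0" for t
    using that assms by (auto intro!: continuous_intros)
  have "((\<lambda>t. 2 / sqrt a * arctan (sqrt t / sqrt a)) \<longlongrightarrow> 2 / sqrt a * arctan (sqrt 0 / sqrt a)) (at_right 0)"
    by (intro tendsto_intros) (use assms in auto)
  then have lim0: "((?F \<circ> real_of_ereal) \<longlongrightarrow> 0) (at_right (ereal 0))"
    unfolding ereal_tendsto_simps by simp
  have "filterlim (\<lambda>t. sqrt t / sqrt a) at_top at_top"
    using assms by (simp add: divide_inverse)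
       (intro filterlim_at_top_mult_tendsto_pos[OF tendsto_const] sqrt_at_top, auto)
  then have "((\<lambda>t. 2 / sqrt a * arctan (sqrt t / sqrt a)) \<longlongrightarrow> 2 / sqrt a * (pi / 2)) at_top"
    by (intro tendsto_intros filterlim_compose[OF tendsto_arctan_at_top])
  then have liminf: "((?F \<circ> real_of_ereal) \<longlongrightarrow> pi / sqrt a) (at_left \<infinity>)"
    unfolding ereal_tendsto_simps by simp
  have 0: "einterval (ereal 0) \<infinity> = {0<..}"
    by (auto simp: einterval_def)
  have "set_integrable lborel (einterval (ereal 0) \<infinity>) (\<lambda>t. 1 / (sqrt t * (t + a)))"
    by (rule interval_integral_FTC_nonneg[OF _ _ _ _ lim0 liminf]) (use deriv cont assms in auto)
  then show "set_integrable lborel {0<..} (\<lambda>t. 1 / (sqrt t * (t + a)))"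
    unfolding 0 .
  have "(LBINT t=ereal 0..\<infinity>. 1 / (sqrt t * (t + a))) = pi / sqrt a - 0"
    by (rule interval_integral_FTC_nonneg[OF _ _ _ _ lim0 liminf]) (use deriv cont assms in auto)
  then show "(LBINT t:{0<..}. 1 / (sqrt t * (t + a))) = pi / sqrt a"
    by (simp add: interval_lebesgue_integral_def 0[unfolded zero_ereal_def[symmetric]] zero_ereal_def[symmetric])
qed

lemma powr_three_halves:
  fixes t :: real
  assumes "0 < t"
  shows "t powr (3 / 2) = t * sqrt t"
proof -
  have "t powr (3 / 2) = t powr (1 + 1 / 2)"
    by simp
  also have "\<dots> = t * sqrt t"
    unfolding powr_add using assms by (simp add: powr_half_sqrt)
  finally show ?thesis .
qed

text \<open>
  From \<open>exp x \<ge> 1 + x\<close>. The majorant has the same total mass as the weight up to a constant, since both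
  scale like \<open>1 / sqrt a\<close>, but its integral is elementary.
\<close>
lemma exp_weight_le_arctan_weight:
  assumes "0 < a" "0 < t"
  shows "exp (- a / t) / t powr (3 / 2) \<le> 1 / (sqrt t * (t + a))"
proof -
  have "(t + a) / t \<le> exp (a / t)"
    using exp_ge_add_one_self[of "a / t"] assms by (simp add: add_divide_distrib)
  then have "inverse (exp (a / t)) \<le> inverse ((t + a) / t)"
    using assms by (intro le_imp_inverse_le) auto
  then have "exp (- a / t) \<le> t / (t + a)"
    by (simp add: exp_minus)
  then have "exp (- a / t) / (t * sqrt t) \<le> t / (t + a) / (t * sqrt t)"
    using assms by (intro divide_right_mono) auto
  also have "\<dots> = 1 / (sqrt t * (t + a))"
    using assms by (simp add: divide_simps)
  finally show ?thesis
    unfolding powr_three_halves[OF assms(2)] .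
qed

text \<open>
  For \<open>l = 0\<close> this is the integral to be estimated, with the heat kernel replaced by an arbitrary
  function \<open>H\<close> of time, so that the kernel and its differences are treated alike.
\<close>
definition weighted_integral :: "real \<Rightarrow> nat \<Rightarrow> (real \<Rightarrow> real) \<Rightarrow> real \<Rightarrow> real" where
  "weighted_integral c l H y = (LBINT t:{0<..}. kernel_deriv c l y t / t powr (3 / 2) * H t)"

lemma heat_integrand_eq:
  "heat_integrand c y j t = kernel_deriv c 0 y t / t powr (3 / 2) * heat_kernel t j"
  by (simp add: heat_integrand_def kernel_deriv_def)

lemma heat_integral_eq:
  "heat_integral c y j = weighted_integral c 0 (\<lambda>t. heat_kernel t j) y"
  by (simp add: heat_integral_def weighted_integral_def heat_integrand_eq)

lemma set_integral_dominated:
  fixes f m :: "real \<Rightarrow> real"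
  assumes f: "f \<in> borel_measurable borel" and m: "set_integrable lborel {0<..} m"
    and le: "\<And>t. 0 < t \<Longrightarrow> \<bar>f t\<bar> \<le> m t"
  shows "set_integrable lborel {0<..} f" "\<bar>LBINT t:{0<..}. f t\<bar> \<le> (LBINT t:{0<..}. m t)"
proof -
  have norm_le: "norm (f t) \<le> norm (m t)" if "0 < t" for t
    using le[OF that] by simp
  show int: "set_integrable lborel {0<..} f"
    by (rule set_integrable_bound[OF m])
       (use f norm_le in \<open>auto simp: set_borel_measurable_def\<close>)
  have "norm (LBINT t:{0<..}. f t) \<le> (LBINT t:{0<..}. norm (f t))"
    by (rule set_integral_norm_bound[OF int])
  also have "\<dots> \<le> (LBINT t:{0<..}. m t)"
    using int m le by (intro set_integral_mono) (auto intro: set_integrable_abs)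
  finally show "\<bar>LBINT t:{0<..}. f t\<bar> \<le> (LBINT t:{0<..}. m t)"
    by simp
qed

lemma weighted_integrand_bound:
  assumes B: "\<And>y t. y > 0 \<Longrightarrow> t > 0 \<Longrightarrow> \<bar>kernel_deriv c l y t\<bar> \<le> B * (y / y ^ l) * exp (- (c / 2 * y\<^sup>2) / t)"
    and "0 \<le> B" "0 < y" "0 < t" and H: "\<bar>H t\<bar> \<le> h"
    and h: "exp (- (c / 2 * y\<^sup>2) / t) / t powr (3 / 2) * h \<le> M * (1 / (sqrt t * (t + a)))"
  shows "\<bar>kernel_deriv c l y t / t powr (3 / 2) * H t\<bar> \<le> B * (y / y ^ l) * M * (1 / (sqrt t * (t + a)))"
proof -
  have "\<bar>kernel_deriv c l y t / t powr (3 / 2) * H t\<bar> = \<bar>kernel_deriv c l y t\<bar> / t powr (3 / 2) * \<bar>H t\<bar>"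
    by (simp add: abs_mult)
  also have "\<dots> \<le> B * (y / y ^ l) * exp (- (c / 2 * y\<^sup>2) / t) / t powr (3 / 2) * h"
    using assms by (intro mult_mono divide_right_mono) auto
  also have "\<dots> = B * (y / y ^ l) * (exp (- (c / 2 * y\<^sup>2) / t) / t powr (3 / 2) * h)"
    by simp
  also have "\<dots> \<le> B * (y / y ^ l) * (M * (1 / (sqrt t * (t + a))))"
    using assms by (intro mult_left_mono h) auto
  finally show ?thesis
    by simp
qed

text \<open>
  The three estimates below differ only in how the exponential that is left over from the polynomial
  combines with a bound \<open>h\<close> for \<open>H\<close> into a multiple of the weight \<open>1 / (sqrt t * (t + a))\<close>.
\<close>
lemma weighted_integral_bound:
  assumes B: "\<And>y t. y > 0 \<Longrightarrow> t > 0 \<Longrightarrow> \<bar>kernel_deriv c l y t\<bar> \<le> B * (y / y ^ l) * exp (- (c / 2 * y\<^sup>2) / t)"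
    and "0 \<le> B" "0 < y" "0 < a"
    and H[measurable]: "H \<in> borel_measurable borel"
    and h: "\<And>t. 0 < t \<Longrightarrow> \<bar>H t\<bar> \<le> h t"
    and hM: "\<And>t. 0 < t \<Longrightarrow> exp (- (c / 2 * y\<^sup>2) / t) / t powr (3 / 2) * h t \<le> M * (1 / (sqrt t * (t + a)))"
  shows "set_integrable lborel {0<..} (\<lambda>t. kernel_deriv c l y t / t powr (3 / 2) * H t)"
    and "\<bar>weighted_integral c l H y\<bar> \<le> B * (y / y ^ l) * M * (pi / sqrt a)"
proof -
  have m: "set_integrable lborel {0<..} (\<lambda>t. B * (y / y ^ l) * M * (1 / (sqrt t * (t + a))))"
    using arctan_weight_integral(1)[OF \<open>0 < a\<close>] by (intro set_integrable_mult_right) auto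
  have f: "(\<lambda>t. kernel_deriv c l y t / t powr (3 / 2) * H t) \<in> borel_measurable borel"
    by measurable
  have "\<bar>kernel_deriv c l y t / t powr (3 / 2) * H t\<bar> \<le> B * (y / y ^ l) * M * (1 / (sqrt t * (t + a)))"
    if "0 < t" for t
    by (rule weighted_integrand_bound[where h = "h t"])
       (assumption | rule B h hM that \<open>0 \<le> B\<close> \<open>0 < y\<close>)+
  note bound = set_integral_dominated[OF f m this]
  show "set_integrable lborel {0<..} (\<lambda>t. kernel_deriv c l y t / t powr (3 / 2) * H t)"
    by (rule bound(1))
  have "\<bar>weighted_integral c l H y\<bar> \<le> (LBINT t:{0<..}. B * (y / y ^ l) * M * (1 / (sqrt t * (t + a))))"
    unfolding weighted_integral_def by (rule bound(2))
  also have "\<dots> = B * (y / y ^ l) * M * (pi / sqrt a)"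
    unfolding set_integral_mult_right arctan_weight_integral(2)[OF \<open>0 < a\<close>] ..
  finally show "\<bar>weighted_integral c l H y\<bar> \<le> B * (y / y ^ l) * M * (pi / sqrt a)" .
qed

lemma exp_weight_mult_le:
  assumes "0 < a" "0 < t" "\<bar>x\<bar> \<le> M"
  shows "exp (- a / t) / t powr (3 / 2) * M \<le> M * (1 / (sqrt t * (t + a)))"
  using mult_right_mono[OF exp_weight_le_arctan_weight[OF assms(1,2)], of M] assms(3) by (simp add: mult.commute)

lemma weighted_integrable:
  assumes "0 < c" "0 < y" and "H \<in> borel_measurable borel" and H: "\<And>t. 0 < t \<Longrightarrow> \<bar>H t\<bar> \<le> M"
  shows "set_integrable lborel {0<..} (\<lambda>t. kernel_deriv c l y t / t powr (3 / 2) * H t)"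
proof -
  from kernel_deriv_bound[OF \<open>0 < c\<close>, of l] obtain B where
    B: "B \<ge> 0" "\<And>y t. y > 0 \<Longrightarrow> t > 0 \<Longrightarrow> \<bar>kernel_deriv c l y t\<bar> \<le> B * (y / y ^ l) * exp (- (c / 2 * y\<^sup>2) / t)"
    by blast
  have a: "0 < c / 2 * y\<^sup>2"
    using assms by simp
  show ?thesis
    by (rule weighted_integral_bound(1)[OF B(2,1) \<open>0 < y\<close> a assms(3) H exp_weight_mult_le[OF a _ H]])
qed

text \<open>
  For \<open>y\<close> within \<open>y\<^sub>0 / 2\<close> of \<open>y\<^sub>0\<close> the integrands of the differentiated integral have a common majorant,
  because the bound on the kernel is worst at the left end \<open>y\<^sub>0 / 2\<close>.
\<close>
lemma weighted_integral_has_derivative: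
  assumes c: "0 < c" and y0: "0 < y\<^sub>0" and H[measurable]: "H \<in> borel_measurable borel"
    and bound: "\<And>t. 0 < t \<Longrightarrow> \<bar>H t\<bar> \<le> M"
  shows "(weighted_integral c l H has_real_derivative weighted_integral c (Suc l) H y\<^sub>0) (at y\<^sub>0)"
proof -
  from kernel_deriv_bound[OF c, of "Suc l"] obtain B where
    B: "B \<ge> 0" "\<And>y t. y > 0 \<Longrightarrow> t > 0 \<Longrightarrow>
      \<bar>kernel_deriv c (Suc l) y t\<bar> \<le> B * (y / y ^ Suc l) * exp (- (c / 2 * y\<^sup>2) / t)"
    by blast
  define F where "F l y t = indicator {0<..} t *\<^sub>R (kernel_deriv c l y t / t powr (3 / 2) * H t)" for l y and t :: real
  define a where "a = c / 2 * (y\<^sub>0 / 2)\<^sup>2"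
  define g where "g t = indicator {0<..} t *\<^sub>R (B * (1 / (y\<^sub>0 / 2) ^ l) * M * (1 / (sqrt t * (t + a))))" for t :: real
  have a: "0 < a"
    using c y0 by (simp add: a_def)
  have "0 \<le> M"
    using bound[of 1] by simp
  have y_pos: "0 < y" "y\<^sub>0 / 2 \<le> y" if "\<bar>y - y\<^sub>0\<bar> < y\<^sub>0 / 2" for y
    using that by (auto simp: field_simps abs_if split: if_splits)
  have "((\<lambda>y. integral\<^sup>L lborel (F l y)) has_real_derivative integral\<^sup>L lborel (F (Suc l) y\<^sub>0)) (at y\<^sub>0)"
  proof (rule has_real_derivative_integral_dominated[where d = "y\<^sub>0 / 2" and g = g])
    show "0 < y\<^sub>0 / 2"
      using y0 by simp
    show "integrable lborel (F l y)" if "\<bar>y - y\<^sub>0\<bar> < y\<^sub>0 / 2" for y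
      using weighted_integrable[OF c y_pos(1)[OF that] H bound] unfolding F_def set_integrable_def .
    show "F (Suc l) y\<^sub>0 \<in> borel_measurable lborel"
      unfolding F_def by measurable
    show "integrable lborel g"
      unfolding g_def
      using set_integrable_mult_right[OF arctan_weight_integral(1)[OF a], of "B * (1 / (y\<^sub>0 / 2) ^ l) * M"]
      by (simp add: set_integrable_def)
    fix y t assume y: "\<bar>y - y\<^sub>0\<bar> < y\<^sub>0 / 2"
    note y_pos = y_pos[OF y]
    show "((\<lambda>y. F l y t) has_real_derivative F (Suc l) y t) (at y)"
    proof (cases "0 < t")
      case True
      have "((\<lambda>y. kernel_deriv c l y t / t powr (3 / 2) * H t) has_real_derivative
          kernel_deriv c (Suc l) y t / t powr (3 / 2) * H t) (at y)"
        using True y_pos by (intro DERIV_cmult_right DERIV_cdivide kernel_deriv_has_derivative) auto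
      with True show ?thesis
        by (simp add: F_def)
    qed (simp add: F_def)
    show "\<bar>F (Suc l) y t\<bar> \<le> g t"
    proof (cases "0 < t")
      case True
      have ay: "0 < c / 2 * y\<^sup>2"
        using c y_pos by simp
      have "\<bar>kernel_deriv c (Suc l) y t / t powr (3 / 2) * H t\<bar> \<le>
          B * (y / y ^ Suc l) * M * (1 / (sqrt t * (t + c / 2 * y\<^sup>2)))"
        by (rule weighted_integrand_bound[where h = M])
           (use B y_pos True bound exp_weight_mult_le[OF ay True bound[OF True]] in auto)
      also have "\<dots> = B * (1 / y ^ l) * M * (1 / (sqrt t * (t + c / 2 * y\<^sup>2)))"
        using y_pos by simp
      also have "\<dots> \<le> B * (1 / (y\<^sub>0 / 2) ^ l) * M * (1 / (sqrt t * (t + a)))"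
      proof (intro mult_mono)
        show "1 / y ^ l \<le> 1 / (y\<^sub>0 / 2) ^ l"
          using y_pos y0 by (intro divide_left_mono power_mono mult_pos_pos zero_less_power) auto
        have "a \<le> c / 2 * y\<^sup>2"
          unfolding a_def using c y0 y_pos by (intro mult_left_mono power_mono) auto
        then show "1 / (sqrt t * (t + c / 2 * y\<^sup>2)) \<le> 1 / (sqrt t * (t + a))"
          using True a by (intro divide_left_mono mult_left_mono mult_pos_pos add_left_mono) auto
      qed (use B \<open>0 \<le> M\<close> y_pos y0 True c in auto)
      finally show ?thesis
        using True by (simp add: F_def g_def)
    qed (simp add: F_def g_def)
  qed
  then show ?thesis
    unfolding F_def set_lebesgue_integral_def[symmetric] weighted_integral_def .
qed

text \<open>
  Since only the values on the open half-line determine the derivatives there, \<open>f\<close> may be any function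
  that agrees with the integral for positive \<open>y\<close>.
\<close>
lemma funpow_deriv_weighted_integral:
  assumes "0 < c" "H \<in> borel_measurable borel" "\<And>t. 0 < t \<Longrightarrow> \<bar>H t\<bar> \<le> M"
    and f: "\<And>y. 0 < y \<Longrightarrow> f y = weighted_integral c 0 H y" and "0 < y"
  shows "(deriv ^^ l) f y = weighted_integral c l H y"
    and "(deriv ^^ l) f differentiable (at y)"
proof -
  have step: "(g has_real_derivative weighted_integral c (Suc k) H y) (at y)"
    if "\<And>y. 0 < y \<Longrightarrow> g y = weighted_integral c k H y" "0 < y" for g k y
    using weighted_integral_has_derivative[OF assms(1) \<open>0 < y\<close> assms(2,3)]
    by (rule has_field_derivative_transform_within_open[where S = "{0<..}"]) (use that in auto)
  have eq: "(deriv ^^ l) f y = weighted_integral c l H y" if "0 < y" for y l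
    using that
  proof (induction l arbitrary: y)
    case 0
    then show ?case
      by (simp add: f)
  next
    case (Suc l)
    from step[OF Suc.IH Suc.prems] show ?case
      by (simp add: DERIV_imp_deriv)
  qed
  show "(deriv ^^ l) f y = weighted_integral c l H y"
    using \<open>0 < y\<close> by (rule eq)
  show "(deriv ^^ l) f differentiable (at y)"
    using step[OF eq \<open>0 < y\<close>] by (auto simp: real_differentiable_def)
qed

lemma weighted_integral_bounded_le:
  assumes c: "0 < c"
  shows "\<exists>C>0. \<forall>y>0. \<forall>H\<in>borel_measurable borel. \<forall>M. (\<forall>t>0. \<bar>H t\<bar> \<le> M) \<longrightarrow>
    \<bar>weighted_integral c l H y\<bar> \<le> C * M / y ^ l"
proof -
  from kernel_deriv_bound[OF c, of l] obtain B where
    B: "B \<ge> 0" "\<And>y t. y > 0 \<Longrightarrow> t > 0 \<Longrightarrow> \<bar>kernel_deriv c l y t\<bar> \<le> B * (y / y ^ l) * exp (- (c / 2 * y\<^sup>2) / t)"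
    by blast
  define C where "C = B * pi / sqrt (c / 2) + 1"
  have bound: "\<bar>weighted_integral c l H y\<bar> \<le> C * M / y ^ l"
    if y: "y > 0" and meas: "H \<in> borel_measurable borel" and H: "\<And>t. t > 0 \<Longrightarrow> \<bar>H t\<bar> \<le> M" for y H M
  proof -
    have a: "0 < c / 2 * y\<^sup>2"
      using c y by simp
    have "0 \<le> M"
      using H[of 1] by simp
    have "\<bar>weighted_integral c l H y\<bar> \<le> B * (y / y ^ l) * M * (pi / sqrt (c / 2 * y\<^sup>2))"
      by (rule weighted_integral_bound(2)[OF B(2,1) y a meas H exp_weight_mult_le[OF a _ H]])
    also have "\<dots> = B * pi / sqrt (c / 2) * (M / y ^ l)"
      unfolding real_sqrt_mult using y by (simp add: field_simps)
    also have "\<dots> \<le> C * (M / y ^ l)"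
      using \<open>0 \<le> M\<close> y by (intro mult_right_mono) (auto simp: C_def)
    finally show ?thesis
      by simp
  qed
  have "C > 0"
    using B c by (auto simp: C_def intro!: add_nonneg_pos)
  with bound show ?thesis
    by blast
qed

text \<open>
  Half of the exponential is spent on \<open>exp (- a / t) / t \<le> 1 / a\<close>; this gains the factor \<open>1/y\<^sup>2\<close>.
\<close>
lemma weighted_integral_inverse_le:
  assumes c: "0 < c"
  shows "\<exists>C>0. \<forall>y>0. \<forall>H\<in>borel_measurable borel. \<forall>M. (\<forall>t>0. \<bar>H t\<bar> \<le> M / t) \<longrightarrow>
    \<bar>weighted_integral c l H y\<bar> \<le> C * M / y ^ (l + 2)"
proof -
  from kernel_deriv_bound[OF c, of l] obtain B where
    B: "B \<ge> 0" "\<And>y t. y > 0 \<Longrightarrow> t > 0 \<Longrightarrow> \<bar>kernel_deriv c l y t\<bar> \<le> B * (y / y ^ l) * exp (- (c / 2 * y\<^sup>2) / t)"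
    by blast
  define C where "C = B * (4 / c) * pi / sqrt (c / 4) + 1"
  have bound: "\<bar>weighted_integral c l H y\<bar> \<le> C * M / y ^ (l + 2)"
    if y: "y > 0" and meas: "H \<in> borel_measurable borel" and H: "\<And>t. t > 0 \<Longrightarrow> \<bar>H t\<bar> \<le> M / t" for y H M
  proof -
    \<comment> \<open>A quarter of \<open>c\<close>: the exponent \<open>c / 2\<close> left over from the polynomial is split once more.\<close>
    define a where "a = c / 4 * y\<^sup>2"
    have a: "0 < a"
      using c y by (simp add: a_def)
    have "0 \<le> M"
      using H[of 1] by simp
    have hM: "exp (- (c / 2 * y\<^sup>2) / t) / t powr (3 / 2) * (M / t) \<le> M / a * (1 / (sqrt t * (t + a)))"
      if t: "0 < t" for t
    proof -
      have "a / t \<le> exp (a / t)"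
        using exp_ge_add_one_self[of "a / t"] by linarith
      then have "a / t * exp (- a / t) \<le> exp (a / t) * exp (- a / t)"
        by (intro mult_right_mono) auto
      then have "1 / t * exp (- a / t) \<le> 1 / a"
        using a t by (simp add: field_simps flip: exp_add)
      then have "exp (- a / t) / t powr (3 / 2) * (1 / t * exp (- a / t)) \<le> 1 / (sqrt t * (t + a)) * (1 / a)"
        using a t by (intro mult_mono exp_weight_le_arctan_weight) auto
      then have "M * (exp (- a / t) / t powr (3 / 2) * (1 / t * exp (- a / t))) \<le> M * (1 / (sqrt t * (t + a)) * (1 / a))"
        using \<open>0 \<le> M\<close> by (rule mult_left_mono)
      moreover have "exp (- (c / 2 * y\<^sup>2) / t) = exp (- a / t) * exp (- a / t)"
        unfolding exp_add[symmetric] a_def by (simp add: field_simps)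
      ultimately show ?thesis
        by (simp add: mult.commute mult.left_commute)
    qed
    have "\<bar>weighted_integral c l H y\<bar> \<le> B * (y / y ^ l) * (M / a) * (pi / sqrt a)"
      by (rule weighted_integral_bound(2)[OF B(2,1) y a meas H hM])
    also have "\<dots> = B * (4 / c) * pi / sqrt (c / 4) * (M / y ^ (l + 2))"
      unfolding a_def real_sqrt_mult using y c by (simp add: field_simps power2_eq_square power_add)
    also have "\<dots> \<le> C * (M / y ^ (l + 2))"
      using \<open>0 \<le> M\<close> y by (intro mult_right_mono) (auto simp: C_def)
    finally show ?thesis
      by simp
  qed
  have "C > 0"
    using B c by (auto simp: C_def intro!: add_nonneg_pos)
  with bound show ?thesis
    by blast
qed

text \<open>
  Here the exponential is merely bounded by 1. The factor \<open>t / (t + k\<^sup>2)\<close> of \<open>H\<close> already turns the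
  weight \<open>t powr - (3 / 2)\<close> into the integrable majorant, with \<open>k\<^sup>2\<close> in place of \<open>c y\<^sup>2 / 2\<close>.
\<close>
lemma weighted_integral_saturating_le:
  assumes c: "0 < c"
  shows "\<exists>C>0. \<forall>y>0. \<forall>H\<in>borel_measurable borel. \<forall>M k. 0 < k \<longrightarrow> (\<forall>t>0. \<bar>H t\<bar> \<le> M * t / (t + k\<^sup>2)) \<longrightarrow>
    \<bar>weighted_integral c l H y\<bar> \<le> C * M * y / (y ^ l * k)"
proof -
  from kernel_deriv_bound[OF c, of l] obtain B where
    B: "B \<ge> 0" "\<And>y t. y > 0 \<Longrightarrow> t > 0 \<Longrightarrow> \<bar>kernel_deriv c l y t\<bar> \<le> B * (y / y ^ l) * exp (- (c / 2 * y\<^sup>2) / t)"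
    by blast
  define C where "C = B * pi + 1"
  have bound: "\<bar>weighted_integral c l H y\<bar> \<le> C * M * y / (y ^ l * k)"
    if y: "y > 0" and meas: "H \<in> borel_measurable borel" and k: "0 < k"
      and H: "\<And>t. t > 0 \<Longrightarrow> \<bar>H t\<bar> \<le> M * t / (t + k\<^sup>2)" for y H M k
  proof -
    have k2: "0 < k\<^sup>2"
      using k by simp
    have "0 \<le> M * 1 / (1 + k\<^sup>2)"
      by (rule order_trans[OF abs_ge_zero H]) simp
    moreover have "0 < 1 + k\<^sup>2"
      by (intro add_pos_nonneg) auto
    ultimately have M: "0 \<le> M"
      by (simp add: zero_le_divide_iff)
    have hM: "exp (- (c / 2 * y\<^sup>2) / t) / t powr (3 / 2) * (M * t / (t + k\<^sup>2)) \<le> M * (1 / (sqrt t * (t + k\<^sup>2)))"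
      if t: "0 < t" for t
    proof -
      have "exp (- (c / 2 * y\<^sup>2) / t) * (M * (1 / (sqrt t * (t + k\<^sup>2)))) \<le> 1 * (M * (1 / (sqrt t * (t + k\<^sup>2))))"
        using t M c by (intro mult_right_mono) auto
      then show ?thesis
        unfolding powr_three_halves[OF t] using t by (simp add: divide_simps)
    qed
    have "\<bar>weighted_integral c l H y\<bar> \<le> B * (y / y ^ l) * M * (pi / sqrt (k\<^sup>2))"
      by (rule weighted_integral_bound(2)[OF B(2,1) y k2 meas H hM])
    also have "\<dots> = B * pi * (M * y / (y ^ l * k))"
      using k by simp
    also have "\<dots> \<le> C * (M * y / (y ^ l * k))"
      using M k y by (intro mult_right_mono) (auto simp: C_def)
    finally show ?thesis
      by simp
  qed
  have "C > 0"
    using B by (auto simp: C_def intro!: add_nonneg_pos)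
  with bound show ?thesis
    by blast
qed

section \<open>The estimates for the heat integral\<close>

lemma delta_left_heat_integral:
  "delta_left (heat_integral c y) j = delta_right (heat_integral c y) (- j)"
proof -
  have "heat_integral c y (- i) = heat_integral c y i" for i
    by (simp add: heat_integral_eq heat_kernel_minus)
  from this[of j] this[of "j - 1"] show ?thesis
    by (simp add: delta_left_def delta_right_def)
qed

lemma delta_right_heat_integral:
  assumes "0 < c" "0 < y"
  shows "delta_right (heat_integral c y) j = weighted_integral c 0 (\<lambda>t. heat_kernel t j - heat_kernel t (j + 1)) y"
proof -
  have int: "set_integrable lborel {0<..} (\<lambda>t. kernel_deriv c 0 y t / t powr (3 / 2) * heat_kernel t i)" for i
    using assms abs_heat_kernel_le_1 by (intro weighted_integrable[where M = 1]) auto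
  show ?thesis
    unfolding delta_right_def heat_integral_eq weighted_integral_def right_diff_distrib
    using set_integral_diff(2)[OF int[of j] int[of "j + 1"]] by simp
qed

theorem lemma8:
  fixes c :: real and l :: nat
  assumes "c > 0"
  shows "(\<forall>y>0. \<forall>j.
            set_integrable lborel {0<..} (heat_integrand c y j) \<and>
            times_differentiable_at l (\<lambda>y. heat_integral c y j) y) \<and>
         (\<exists>C>0. \<forall>y>0.
            (\<forall>j. \<bar>(deriv ^^ l) (\<lambda>y. heat_integral c y j) y\<bar>
                   \<le> C / (y ^ l * (1 + real_of_int \<bar>j\<bar>))) \<and>
            (\<forall>j. j \<noteq> 0 \<longrightarrow>
                 \<bar>(deriv ^^ l) (\<lambda>y. heat_integral c y j) y\<bar>
                   \<le> C * y / (y ^ l * (real_of_int \<bar>j\<bar>)\<^sup>2)) \<and>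
            (\<forall>\<delta>\<in>{delta_right, delta_left}.
               (\<forall>j. \<bar>(deriv ^^ l) (\<lambda>y. \<delta> (heat_integral c y) j) y\<bar>
                      \<le> C / y ^ (l + 2)) \<and>
               (\<forall>j. j \<noteq> 0 \<longrightarrow>
                    \<bar>(deriv ^^ l) (\<lambda>y. \<delta> (heat_integral c y) j) y\<bar>
                      \<le> C / (y ^ l * (real_of_int \<bar>j\<bar>)\<^sup>2))))"
proof (rule conjI)
  define G where "G j t = heat_kernel t j" for j t
  have G_meas [measurable]: "G j \<in> borel_measurable borel" for j
    unfolding G_def by measurable
  have G_le_1: "\<bar>G j t\<bar> \<le> 1" if "0 < t" for j t
    using abs_heat_kernel_le_1[of t j] that by (simp add: G_def)
  have heat_eq: "heat_integral c y j = weighted_integral c 0 (G j) y" for y j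
    by (simp add: heat_integral_eq G_def[abs_def])
  have deriv_heat: "(deriv ^^ k) (\<lambda>y. heat_integral c y j) y = weighted_integral c k (G j) y"
    and differentiable_heat: "(deriv ^^ k) (\<lambda>y. heat_integral c y j) differentiable (at y)"
    if "0 < y" for y k j
    by (rule funpow_deriv_weighted_integral[OF assms G_meas G_le_1 heat_eq that], assumption)+
  define D where "D j t = G j t - G (j + 1) t" for j t
  have D_meas [measurable]: "D j \<in> borel_measurable borel" for j
    unfolding D_def by measurable
  have D_le_2: "\<bar>D j t\<bar> \<le> 2" if "0 < t" for j t
    using G_le_1[OF that, of j] G_le_1[OF that, of "j + 1"] unfolding D_def by linarith
  have delta_eq: "delta_right (heat_integral c y) j = weighted_integral c 0 (D j) y" if "0 < y" for y j
    using delta_right_heat_integral[OF assms that, of j] by (simp add: D_def[abs_def] G_def)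
  have deriv_delta: "(deriv ^^ k) (\<lambda>y. delta_right (heat_integral c y) j) y = weighted_integral c k (D j) y"
    if "0 < y" for y k j
    by (rule funpow_deriv_weighted_integral(1)[OF assms D_meas D_le_2 delta_eq that])

  show "\<forall>y>0. \<forall>j. set_integrable lborel {0<..} (heat_integrand c y j) \<and>
      times_differentiable_at l (\<lambda>y. heat_integral c y j) y"
  proof (intro allI impI conjI)
    fix y :: real and j assume y: "0 < y"
    show "set_integrable lborel {0<..} (heat_integrand c y j)"
      using weighted_integrable[OF assms y G_meas G_le_1, of 0 j]
      by (simp add: heat_integrand_eq[abs_def] G_def)
    show "times_differentiable_at l (\<lambda>y. heat_integral c y j) y"
      unfolding times_differentiable_at_def using differentiable_heat[OF y] by blast
  qed

  obtain C1 where C1: "C1 > 0"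
    "\<forall>y>0. \<forall>H\<in>borel_measurable borel. \<forall>M. (\<forall>t>0. \<bar>H t\<bar> \<le> M) \<longrightarrow>
      \<bar>weighted_integral c l H y\<bar> \<le> C1 * M / y ^ l"
    using weighted_integral_bounded_le[OF assms, of l] by blast
  obtain C2 where C2: "C2 > 0"
    "\<forall>y>0. \<forall>H\<in>borel_measurable borel. \<forall>M. (\<forall>t>0. \<bar>H t\<bar> \<le> M / t) \<longrightarrow>
      \<bar>weighted_integral c l H y\<bar> \<le> C2 * M / y ^ (l + 2)"
    using weighted_integral_inverse_le[OF assms, of l] by blast
  obtain C3 where C3: "C3 > 0"
    "\<forall>y>0. \<forall>H\<in>borel_measurable borel. \<forall>M k. 0 < k \<longrightarrow> (\<forall>t>0. \<bar>H t\<bar> \<le> M * t / (t + k\<^sup>2)) \<longrightarrow>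
      \<bar>weighted_integral c l H y\<bar> \<le> C3 * M * y / (y ^ l * k)"
    using weighted_integral_saturating_le[OF assms, of l] by blast
  define C where "C = 13 * C1 + C2 + 25 * C3"
  have C: "0 < C" "2 * C1 \<le> C" "13 * C1 \<le> C" "C2 \<le> C" "25 * C3 \<le> C"
    using C1(1) C2(1) C3(1) by (auto simp: C_def)

  have i: "\<bar>(deriv ^^ l) (\<lambda>y. heat_integral c y j) y\<bar> \<le> C / (y ^ l * (1 + real_of_int \<bar>j\<bar>))"
    if y: "0 < y" for y j
  proof -
    have "\<bar>G j t\<bar> \<le> 2 / (1 + real_of_int \<bar>j\<bar>)" if "0 < t" for t
      using G_le_1[OF that, of j] abs_index_times_heat_kernel_bound[OF that, of j]
      by (simp add: G_def field_simps)
    from C1(2)[rule_format, OF y G_meas this] have "\<bar>(deriv ^^ l) (\<lambda>y. heat_integral c y j) y\<bar> \<le>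
        2 * C1 / (y ^ l * (1 + real_of_int \<bar>j\<bar>))"
      unfolding deriv_heat[OF y] by (simp add: mult.commute)
    also have "\<dots> \<le> C / (y ^ l * (1 + real_of_int \<bar>j\<bar>))"
      using y C by (intro divide_right_mono) auto
    finally show ?thesis .
  qed
  have ii: "\<bar>(deriv ^^ l) (\<lambda>y. heat_integral c y j) y\<bar> \<le> C * y / (y ^ l * (real_of_int \<bar>j\<bar>)\<^sup>2)"
    if y: "0 < y" and j: "j \<noteq> 0" for y j
  proof -
    define k where "k = real_of_int \<bar>j\<bar>"
    have k: "0 < k"
      using j by (simp add: k_def)
    \<comment> \<open>Of the bounds \<open>1 / k\<close> and \<open>24 t / k\<^sup>3\<close> the second is the better one for small \<open>t\<close>; adding \<open>t\<close> times the first
      to the second gives one bound that serves both ranges and is integrable against the weight.\<close>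
    have "\<bar>G j t\<bar> \<le> 25 / k * t / (t + k\<^sup>2)" if t: "0 < t" for t
    proof -
      have "t * (k * \<bar>G j t\<bar>) \<le> t * 1"
        using abs_index_times_heat_kernel_bound[OF t, of j] t by (intro mult_left_mono) (auto simp: G_def k_def)
      moreover have "k ^ 3 * \<bar>G j t\<bar> \<le> 24 * t"
        using cube_times_heat_kernel_bound[OF t, of j] by (simp add: G_def k_def)
      ultimately have "\<bar>G j t\<bar> * (k * (t + k\<^sup>2)) \<le> 25 * t"
        by (simp add: algebra_simps power2_eq_square power3_eq_cube)
      moreover have "0 < k * (t + k\<^sup>2)"
        using k t by (simp add: add_pos_pos)
      ultimately have "\<bar>G j t\<bar> \<le> 25 * t / (k * (t + k\<^sup>2))"
        by (simp only: pos_le_divide_eq)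
      then show ?thesis
        by simp
    qed
    from C3(2)[rule_format, OF y G_meas k this] have "\<bar>(deriv ^^ l) (\<lambda>y. heat_integral c y j) y\<bar> \<le>
        25 * C3 * y / (y ^ l * k\<^sup>2)"
      unfolding deriv_heat[OF y] by (simp add: power2_eq_square mult.commute mult.left_commute)
    also have "\<dots> \<le> C * y / (y ^ l * k\<^sup>2)"
      using y C by (intro divide_right_mono mult_right_mono) auto
    finally show ?thesis
      unfolding k_def .
  qed
  have iii: "\<bar>(deriv ^^ l) (\<lambda>y. delta_right (heat_integral c y) j) y\<bar> \<le> C / y ^ (l + 2)"
    if y: "0 < y" for y j
  proof -
    have "\<bar>D j t\<bar> \<le> 1 / t" if "0 < t" for t
      using heat_kernel_difference_bound[OF that, of j] that by (simp add: D_def G_def field_simps)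
    from C2(2)[rule_format, OF y D_meas this] have "\<bar>(deriv ^^ l) (\<lambda>y. delta_right (heat_integral c y) j) y\<bar> \<le> C2 / y ^ (l + 2)"
      unfolding deriv_delta[OF y] by simp
    also have "\<dots> \<le> C / y ^ (l + 2)"
      using y C by (intro divide_right_mono) auto
    finally show ?thesis .
  qed
  have iv: "\<bar>(deriv ^^ l) (\<lambda>y. delta_right (heat_integral c y) j) y\<bar> \<le> C / (y ^ l * (real_of_int \<bar>j\<bar>)\<^sup>2)"
    if y: "0 < y" and j: "j \<noteq> 0" for y j
  proof -
    have "\<bar>D j t\<bar> \<le> 13 / (real_of_int j)\<^sup>2" if "0 < t" for t
      using square_times_difference_bound[OF that, of j] j by (simp add: D_def G_def field_simps)
    from C1(2)[rule_format, OF y D_meas this] have "\<bar>(deriv ^^ l) (\<lambda>y. delta_right (heat_integral c y) j) y\<bar> \<le>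
        13 * C1 / (y ^ l * (real_of_int \<bar>j\<bar>)\<^sup>2)"
      unfolding deriv_delta[OF y] by (simp add: mult.commute)
    also have "\<dots> \<le> C / (y ^ l * (real_of_int \<bar>j\<bar>)\<^sup>2)"
      using y C by (intro divide_right_mono) auto
    finally show ?thesis .
  qed
  have left: "(\<lambda>y. delta_left (heat_integral c y) j) = (\<lambda>y. delta_right (heat_integral c y) (- j))" for j
    by (simp add: delta_left_heat_integral)
  have delta: "(\<forall>j. \<bar>(deriv ^^ l) (\<lambda>y. \<delta> (heat_integral c y) j) y\<bar> \<le> C / y ^ (l + 2)) \<and>
      (\<forall>j. j \<noteq> 0 \<longrightarrow>
        \<bar>(deriv ^^ l) (\<lambda>y. \<delta> (heat_integral c y) j) y\<bar> \<le> C / (y ^ l * (real_of_int \<bar>j\<bar>)\<^sup>2))"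
    if y: "0 < y" and \<delta>: "\<delta> \<in> {delta_right, delta_left}" for y \<delta>
  proof -
    from \<delta> consider "\<delta> = delta_right" | "\<delta> = delta_left"
      by blast
    then show ?thesis
    proof cases
      case 1
      show ?thesis
        unfolding 1 by (intro conjI allI impI iii[OF y] iv[OF y])
    next
      case 2
      have iv_left: "\<bar>(deriv ^^ l) (\<lambda>y. delta_right (heat_integral c y) (- j)) y\<bar> \<le> C / (y ^ l * (real_of_int \<bar>j\<bar>)\<^sup>2)"
        if "j \<noteq> 0" for j
        using iv[OF y, of "- j"] that by simp
      show ?thesis
        unfolding 2 left by (intro conjI allI impI iii[OF y] iv_left)
    qed
  qed
  show "\<exists>C>0. \<forall>y>0.
            (\<forall>j. \<bar>(deriv ^^ l) (\<lambda>y. heat_integral c y j) y\<bar>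
                   \<le> C / (y ^ l * (1 + real_of_int \<bar>j\<bar>))) \<and>
            (\<forall>j. j \<noteq> 0 \<longrightarrow>
                 \<bar>(deriv ^^ l) (\<lambda>y. heat_integral c y j) y\<bar>
                   \<le> C * y / (y ^ l * (real_of_int \<bar>j\<bar>)\<^sup>2)) \<and>
            (\<forall>\<delta>\<in>{delta_right, delta_left}.
               (\<forall>j. \<bar>(deriv ^^ l) (\<lambda>y. \<delta> (heat_integral c y) j) y\<bar>
                      \<le> C / y ^ (l + 2)) \<and>
               (\<forall>j. j \<noteq> 0 \<longrightarrow>
                    \<bar>(deriv ^^ l) (\<lambda>y. \<delta> (heat_integral c y) j) y\<bar>
                      \<le> C / (y ^ l * (real_of_int \<bar>j\<bar>)\<^sup>2)))"
  proof (intro exI[of _ C] conjI[OF C(1)] allI impI)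
    fix y :: real assume y: "0 < y"
    show "(\<forall>j. \<bar>(deriv ^^ l) (\<lambda>y. heat_integral c y j) y\<bar>
               \<le> C / (y ^ l * (1 + real_of_int \<bar>j\<bar>))) \<and>
        (\<forall>j. j \<noteq> 0 \<longrightarrow>
             \<bar>(deriv ^^ l) (\<lambda>y. heat_integral c y j) y\<bar>
               \<le> C * y / (y ^ l * (real_of_int \<bar>j\<bar>)\<^sup>2)) \<and>
        (\<forall>\<delta>\<in>{delta_right, delta_left}.
           (\<forall>j. \<bar>(deriv ^^ l) (\<lambda>y. \<delta> (heat_integral c y) j) y\<bar>
                  \<le> C / y ^ (l + 2)) \<and>
           (\<forall>j. j \<noteq> 0 \<longrightarrow>
                \<bar>(deriv ^^ l) (\<lambda>y. \<delta> (heat_integral c y) j) y\<bar>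
                  \<le> C / (y ^ l * (real_of_int \<bar>j\<bar>)\<^sup>2)))"
      by (rule conjI[OF _ conjI[OF _ ballI]]) (intro allI impI i[OF y] ii[OF y] delta[OF y]; assumption)+
  qed
qed

end
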